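(* Let $\gamma>-1/2$ and, for $p\in[0,p_c)$, let $(\mathcal{G}^{(p)}(t))_{t\ge0}$ be the continuous centered Gaussian process starting at $0$ with the covariance kernel given in the context. Then the processes $(\mathcal{G}^{(p)}(t))_{t\ge0}$ are continuous in $p\in[0,p_c)$ under the topology of weak convergence, as processes in $C[0,\infty)$; that is, for every $p_0\in[0,p_c)$, $\mathcal{G}^{(p)}\to\mathcal{G}^{(p_0)}$ weakly in $C[0,\infty)$ as $p\to p_0$ within $[0,p_c)$.
   Context: $p_c=(\gamma+\frac12)/(\gamma+1)$, $\widehat p=\gamma/(\gamma+1)$. For $0\le s\le t$, the covariance kernel is $$\mathbb{E}(\mathcal{G}^{(p)}(s)\mathcal{G}^{(p)}(t))=\begin{cases}\dfrac{s}{(1-p)(\gamma-p(\gamma+1))}\left(\gamma-\dfrac{p\,((2-p)(\gamma+1)-1)}{2(1-p)(\gamma+1)-1}\left(\dfrac st\right)^{\gamma-p(\gamma+1)}\right), & p\ne\widehat p,\\[3mm] s\left(\gamma^2+(\gamma+1)^2-\gamma(\gamma+1)\log\dfrac st\right), & p=\widehat p,\end{cases}$$ with value $0$ when $s=0$. (This process is the weak limit of the $\sqrt n$-scaled step reinforced random walk with regularly varying memory of index $\gamma$ and recollection probability $p$.) $C[0,\infty)$ is the space of continuous real functions on $[0,\infty)$ with the topology of uniform convergence on compact sets. *)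

theory Defs
  imports "HOL-Probability.Probability"
begin

subsection \<open>The space of continuous functions on the half-line\<close>

text \<open>The value at negative arguments is the dummy of \<^const>\<open>restrict\<close>, so that an element of
  the type is determined by its values on the half-line.\<close>

typedef cpath = "{f :: real \<Rightarrow> real. continuous_on {0..} f \<and> f \<in> extensional {0..}}"
proof
  have "continuous_on {0..} (restrict (\<lambda>_. 0) {0..} :: real \<Rightarrow> real)"
    by (rule continuous_on_eq[OF continuous_on_const[of _ 0]]) simp
  then show "restrict (\<lambda>_. 0) {0..} \<in> {f :: real \<Rightarrow> real. continuous_on {0..} f \<and> f \<in> extensional {0..}}"
    by simp
qed

text \<open>The topology of uniform convergence on compact sets; see \<open>tendsto_cpath_iff\<close> below.\<close>

instantiation cpath :: topological_space
begin

definition open_cpath :: "cpath set \<Rightarrow> bool" where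
  "open_cpath U \<longleftrightarrow> (\<forall>f\<in>U. \<exists>K e. compact K \<and> K \<subseteq> {0..} \<and> 0 < e \<and>
      (\<forall>g. (\<forall>t\<in>K. dist (Rep_cpath g t) (Rep_cpath f t) < e) \<longrightarrow> g \<in> U))"

instance
proof
  show "open (UNIV :: cpath set)"
    unfolding open_cpath_def by (auto intro!: exI[of _ "{}"] exI[of _ 1])
next
  fix S T :: "cpath set" assume S: "open S" and T: "open T"
  show "open (S \<inter> T)"
    unfolding open_cpath_def
  proof
    fix f assume f: "f \<in> S \<inter> T"
    obtain K d where K: "compact K" "K \<subseteq> {0..}" "0 < d"
      "\<And>g. (\<forall>t\<in>K. dist (Rep_cpath g t) (Rep_cpath f t) < d) \<Longrightarrow> g \<in> S"
      using S f unfolding open_cpath_def by (metis IntD1)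
    obtain L e where L: "compact L" "L \<subseteq> {0..}" "0 < e"
      "\<And>g. (\<forall>t\<in>L. dist (Rep_cpath g t) (Rep_cpath f t) < e) \<Longrightarrow> g \<in> T"
      using T f unfolding open_cpath_def by (metis IntD2)
    show "\<exists>K e. compact K \<and> K \<subseteq> {0..} \<and> 0 < e \<and>
      (\<forall>g. (\<forall>t\<in>K. dist (Rep_cpath g t) (Rep_cpath f t) < e) \<longrightarrow> g \<in> S \<inter> T)"
      using K L by (intro exI[of _ "K \<union> L"] exI[of _ "min d e"]) (auto intro: compact_Un)
  qed
next
  fix \<K> :: "cpath set set" assume "\<forall>S\<in>\<K>. open S"
  then show "open (\<Union>\<K>)"
    unfolding open_cpath_def by (meson UnionE UnionI)
qed

end

lemma tendsto_cpath_iff: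
  "(f \<longlongrightarrow> l) F \<longleftrightarrow>
    (\<forall>K. compact K \<and> K \<subseteq> {0..} \<longrightarrow> uniform_limit K (\<lambda>i. Rep_cpath (f i)) (Rep_cpath l) F)"
proof safe
  fix K :: "real set" assume lim: "(f \<longlongrightarrow> l) F" and K: "compact K" "K \<subseteq> {0..}"
  show "uniform_limit K (\<lambda>i. Rep_cpath (f i)) (Rep_cpath l) F"
  proof (rule uniform_limitI)
    fix e :: real assume e: "0 < e"
    define U where "U = {g. \<exists>d<e. \<forall>t\<in>K. dist (Rep_cpath g t) (Rep_cpath l t) \<le> d}"
    have "open U"
      unfolding open_cpath_def
    proof
      fix g assume "g \<in> U"
      then obtain d where d: "d < e" "\<forall>t\<in>K. dist (Rep_cpath g t) (Rep_cpath l t) \<le> d"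
        by (auto simp: U_def)
      have "h \<in> U" if h: "\<forall>t\<in>K. dist (Rep_cpath h t) (Rep_cpath g t) < (e - d) / 2" for h
      proof -
        have "dist (Rep_cpath h t) (Rep_cpath l t) \<le> (e + d) / 2" if "t \<in> K" for t
        proof -
          have "dist (Rep_cpath h t) (Rep_cpath l t)
              \<le> dist (Rep_cpath h t) (Rep_cpath g t) + dist (Rep_cpath g t) (Rep_cpath l t)"
            by (rule dist_triangle)
          also have "\<dots> \<le> (e - d) / 2 + d"
            using h d that by (intro add_mono) (auto intro: less_imp_le)
          finally show ?thesis by (simp add: field_simps)
        qed
        moreover have "(e + d) / 2 < e" using d by simp
        ultimately show ?thesis unfolding U_def by blast
      qed
      then show "\<exists>K e. compact K \<and> K \<subseteq> {0..} \<and> 0 < e \<and>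
          (\<forall>h. (\<forall>t\<in>K. dist (Rep_cpath h t) (Rep_cpath g t) < e) \<longrightarrow> h \<in> U)"
        using K d by (intro exI[of _ K] exI[of _ "(e - d) / 2"]) auto
    qed
    moreover have "l \<in> U" using e by (auto simp: U_def)
    ultimately have "\<forall>\<^sub>F i in F. f i \<in> U" using lim by (auto dest: topological_tendstoD)
    then show "\<forall>\<^sub>F i in F. \<forall>t\<in>K. dist (Rep_cpath (f i) t) (Rep_cpath l t) < e"
      by eventually_elim (auto simp: U_def)
  qed
next
  assume *: "\<forall>K. compact K \<and> K \<subseteq> {0..} \<longrightarrow> uniform_limit K (\<lambda>i. Rep_cpath (f i)) (Rep_cpath l) F"
  show "(f \<longlongrightarrow> l) F"
  proof (rule topological_tendstoI)
    fix U assume "open U" "l \<in> U"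
    then obtain K e where K: "compact K" "K \<subseteq> {0..}" "0 < e"
      "\<And>g. (\<forall>t\<in>K. dist (Rep_cpath g t) (Rep_cpath l t) < e) \<Longrightarrow> g \<in> U"
      unfolding open_cpath_def by metis
    have "\<forall>\<^sub>F i in F. \<forall>t\<in>K. dist (Rep_cpath (f i) t) (Rep_cpath l t) < e"
      using * K by (auto dest: uniform_limitD)
    then show "\<forall>\<^sub>F i in F. f i \<in> U"
      by eventually_elim (rule K(4))
  qed
qed

subsection \<open>Weak convergence of Borel probability measures\<close>

text \<open>The library's \<^const>\<open>weak_conv_m\<close> is restricted to sequences of measures on the real line.\<close>

definition weakly_converges ::
    "('i \<Rightarrow> 'b :: topological_space measure) \<Rightarrow> 'b measure \<Rightarrow> 'i filter \<Rightarrow> bool" where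
  "weakly_converges \<mu> \<nu> F \<longleftrightarrow>
     (\<forall>\<^sub>F i in F. prob_space (\<mu> i) \<and> sets (\<mu> i) = sets borel) \<and>
     prob_space \<nu> \<and> sets \<nu> = sets borel \<and>
     (\<forall>\<phi> :: 'b \<Rightarrow> real. continuous_on UNIV \<phi> \<and> bounded (range \<phi>) \<longrightarrow>
        ((\<lambda>i. \<integral>x. \<phi> x \<partial>\<mu> i) \<longlongrightarrow> (\<integral>x. \<phi> x \<partial>\<nu>)) F)"

subsection \<open>Gaussian processes indexed by the half-line\<close>

text \<open>Degenerate (almost surely constant) variables count as Gaussian.\<close>

definition gaussian_rv :: "'a measure \<Rightarrow> ('a \<Rightarrow> real) \<Rightarrow> bool" where
  "gaussian_rv M X \<longleftrightarrow> X \<in> borel_measurable M \<and>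
     ((\<exists>c. AE \<omega> in M. X \<omega> = c) \<or>
      (\<exists>\<mu> \<sigma>. 0 < \<sigma> \<and> distributed M lborel X (\<lambda>x. ennreal (normal_density \<mu> \<sigma> x))))"

text \<open>All finite-dimensional marginals are multivariate normal, i.e. all finite linear
  combinations of the process are Gaussian.\<close>

definition gaussian_process :: "'a measure \<Rightarrow> (real \<Rightarrow> 'a \<Rightarrow> real) \<Rightarrow> bool" where
  "gaussian_process M X \<longleftrightarrow> prob_space M \<and>
     (\<forall>I a. finite I \<and> I \<subseteq> {0..} \<longrightarrow> gaussian_rv M (\<lambda>\<omega>. \<Sum>t\<in>I. a t * X t \<omega>))"

definition sample_path :: "(real \<Rightarrow> 'a \<Rightarrow> real) \<Rightarrow> 'a \<Rightarrow> cpath" where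
  "sample_path X \<omega> = Abs_cpath (restrict (\<lambda>t. X t \<omega>) {0..})"

definition path_law :: "'a measure \<Rightarrow> (real \<Rightarrow> 'a \<Rightarrow> real) \<Rightarrow> cpath measure" where
  "path_law M X = distr M borel (sample_path X)"

subsection \<open>The limit process of the step reinforced random walk\<close>

definition p_crit :: "real \<Rightarrow> real" where
  "p_crit \<gamma> = (\<gamma> + 1/2) / (\<gamma> + 1)"

definition p_hat :: "real \<Rightarrow> real" where
  "p_hat \<gamma> = \<gamma> / (\<gamma> + 1)"

text \<open>Only meaningful for \<open>0 \<le> s \<le> t\<close>.\<close>

definition G_cov :: "real \<Rightarrow> real \<Rightarrow> real \<Rightarrow> real \<Rightarrow> real" where
  "G_cov \<gamma> p s t =
     (if s = 0 then 0
      else if p \<noteq> p_hat \<gamma> then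
        s / ((1 - p) * (\<gamma> - p * (\<gamma> + 1))) *
          (\<gamma> - p * ((2 - p) * (\<gamma> + 1) - 1) / (2 * (1 - p) * (\<gamma> + 1) - 1)
               * (s / t) powr (\<gamma> - p * (\<gamma> + 1)))
      else s * (\<gamma>\<^sup>2 + (\<gamma> + 1)\<^sup>2 - \<gamma> * (\<gamma> + 1) * ln (s / t)))"

definition is_G_process :: "real \<Rightarrow> real \<Rightarrow> 'a measure \<Rightarrow> (real \<Rightarrow> 'a \<Rightarrow> real) \<Rightarrow> bool" where
  "is_G_process \<gamma> p M X \<longleftrightarrow>
     gaussian_process M X \<and>
     (\<forall>t\<ge>0. (\<integral>\<omega>. X t \<omega> \<partial>M) = 0) \<and>
     (\<forall>s t. 0 \<le> s \<and> s \<le> t \<longrightarrow> (\<integral>\<omega>. X s \<omega> * X t \<omega> \<partial>M) = G_cov \<gamma> p s t) \<and>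
     (\<forall>\<omega>\<in>space M. X 0 \<omega> = 0 \<and> continuous_on {0..} (\<lambda>t. X t \<omega>))"

end

theory Submission
  imports Defs
begin

text \<open>Weak convergence on \<open>C[0,\<infinity>)\<close> is obtained without Prokhorov's theorem or a multivariate continuity
  theorem. The finite sums of functions \<open>x \<mapsto> c cos (\<Sum> a\<^sub>t x(t) + b)\<close> form an algebra that separates
  paths, so by Stone-Weierstrass they approximate a bounded continuous functional uniformly on any compact
  set of paths; a polynomial truncation keeps the approximation bounded elsewhere. Hence it suffices that the
  expectations of these functions converge and that the laws are uniformly tight. For centered Gaussian
  processes the former are \<open>exp (- \<sigma>\<^sup>2 / 2) cos b\<close>, where \<open>\<sigma>\<^sup>2\<close> is a finite combination of kernel values, each
  continuous in \<open>p\<close>. Tightness follows from dyadic chaining, because the variance of an increment over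
  \<open>[s, t]\<close> is at most \<open>L (t - s)\<close> with \<open>L\<close> locally bounded in \<open>p\<close>, so that its fourth moment is at most
  \<open>3 L\<^sup>2 (t - s)\<^sup>2\<close>.\<close>

subsection \<open>Borel measurability of sample paths\<close>

text \<open>Rounding down to the grid of mesh 2^-k. The numerator is a natural number, so grid
  points are literally of the form \<open>real i / 2 ^ k\<close>, and negative \<open>t\<close> go
  to 0.\<close>

definition dyadic_floor :: "nat \<Rightarrow> real \<Rightarrow> real" where
  "dyadic_floor k t = real (nat \<lfloor>2 ^ k * t\<rfloor>) / 2 ^ k"

lemma dyadic_floor_nonneg: "0 \<le> dyadic_floor k t"
  by (simp add: dyadic_floor_def)

lemma dyadic_floor_le: "0 \<le> t \<Longrightarrow> dyadic_floor k t \<le> t"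
  by (simp add: dyadic_floor_def field_simps)

lemma dyadic_floor_gt: "t - 1 / 2 ^ k < dyadic_floor k t"
proof -
  have "2 ^ k * t - 1 < real (nat \<lfloor>2 ^ k * t\<rfloor>)" by linarith
  then have "(2 ^ k * t - 1) / 2 ^ k < dyadic_floor k t"
    unfolding dyadic_floor_def by (rule divide_strict_right_mono) simp
  then show ?thesis by (simp add: diff_divide_distrib)
qed

lemma dyadic_floor_tendsto:
  assumes "0 \<le> t"
  shows "(\<lambda>k. dyadic_floor k t) \<longlonglongrightarrow> t"
proof (rule tendsto_sandwich)
  have "(\<lambda>k. t - (1 / 2) ^ k) \<longlonglongrightarrow> t - 0"
    by (intro tendsto_intros LIMSEQ_power_zero) auto
  then show "(\<lambda>k. t - 1 / 2 ^ k) \<longlonglongrightarrow> t"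
    by (simp add: power_one_over)
  show "\<forall>\<^sub>F k in sequentially. t - 1 / 2 ^ k \<le> dyadic_floor k t"
    using dyadic_floor_gt by (auto intro!: always_eventually less_imp_le)
  show "\<forall>\<^sub>F k in sequentially. dyadic_floor k t \<le> t"
    using dyadic_floor_le[OF assms] by auto
qed auto

text \<open>Carries closed conditions from the countable dyadic grid to all times of the
  half-line.\<close>

lemma continuous_dyadic_floor_tendsto:
  fixes f :: "real \<Rightarrow> 'b :: topological_space"
  assumes "continuous_on {0..} f" "0 \<le> t"
  shows "(\<lambda>k. f (dyadic_floor k t)) \<longlonglongrightarrow> f t"
  using assms dyadic_floor_tendsto[of t] dyadic_floor_nonneg
  by (intro continuous_on_tendsto_compose[where f = f and s = "{0..}"]) auto

lemma Rep_cpath_continuous: "continuous_on {0..} (Rep_cpath x)"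
  using Rep_cpath[of x] by simp

lemma Rep_cpath_Abs_restrict:
  assumes "continuous_on {0..} f"
  shows "Rep_cpath (Abs_cpath (restrict f {0..})) = restrict f {0..}"
proof (rule Abs_cpath_inverse)
  have "continuous_on {0..} (restrict f {0..})"
    by (rule continuous_on_eq[OF assms]) simp
  then show "restrict f {0..} \<in> {f. continuous_on {0..} f \<and> f \<in> extensional {0..}}"
    by simp
qed

text \<open>A compact subset of the half-line lies in some \<open>{0..real N}\<close>, so countably
  many windows describe all neighbourhoods.\<close>

lemma open_cpathE:
  assumes "open U" "x \<in> U"
  obtains N :: nat and e where "0 < e"
    "\<And>y. (\<And>t. t \<in> {0..real N} \<Longrightarrow> \<bar>Rep_cpath y t - Rep_cpath x t\<bar> < e) \<Longrightarrow> y \<in> U"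
proof -
  obtain K e where K: "compact K" "K \<subseteq> {0..}" "0 < e"
    "\<And>y. (\<forall>t\<in>K. dist (Rep_cpath y t) (Rep_cpath x t) < e) \<Longrightarrow> y \<in> U"
    using assms unfolding open_cpath_def by metis
  obtain b where "\<And>t. t \<in> K \<Longrightarrow> \<bar>t\<bar> \<le> b"
    using compact_imp_bounded[OF K(1)] by (auto simp: bounded_iff)
  then have "t \<in> {0..real (nat \<lceil>b\<rceil>)}" if "t \<in> K" for t
    using K(2) that by (smt (verit, best) atLeastAtMost_iff atLeast_iff real_nat_ceiling_ge subsetD)
  then have "K \<subseteq> {0..real (nat \<lceil>b\<rceil>)}" by blast
  then show thesis
    using K(3,4) by (intro that[of e "nat \<lceil>b\<rceil>"]) (auto simp: dist_real_def subset_iff)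
qed

text \<open>Coefficient lists over \<open>rat\<close> form a countable type, which makes the union
  in \<open>sample_path_measurable\<close> countable.\<close>

definition rat_poly :: "rat list \<Rightarrow> real \<Rightarrow> real" where
  "rat_poly qs t = (\<Sum>i<length qs. of_rat (qs ! i) * t ^ i)"

lemma rat_poly_dense:
  assumes f: "continuous_on {0..real N} f" and e: "0 < e"
  obtains qs where "\<And>t. t \<in> {0..real N} \<Longrightarrow> \<bar>rat_poly qs t - f t\<bar> < e"
proof -
  obtain g where g: "real_polynomial_function g" "\<And>t. t \<in> {0..real N} \<Longrightarrow> \<bar>f t - g t\<bar> < e / 2"
    using Stone_Weierstrass_real_polynomial_function[of "{0..real N}" f "e / 2"] f e by auto
  obtain a n where an: "g = (\<lambda>t. \<Sum>i\<le>n. a i * t ^ i)"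
    using g(1) by (auto simp: real_polynomial_function_iff_sum)
  define C where "C = (\<Sum>i\<le>n. real N ^ i)"
  have C: "0 \<le> C" by (auto simp: C_def intro!: sum_nonneg)
  \<comment> \<open>Moving every coefficient by at most \<open>d\<close> moves the polynomial on
    \<open>{0..real N}\<close> by at most \<open>d * C\<close>, hence by at most
    \<open>e / 2\<close>.\<close>
  define d where "d = e / (2 * (C + 1))"
  have d: "0 < d" using C e by (simp add: d_def)
  have "\<exists>q. a i - d < of_rat q \<and> of_rat q < a i" for i
    using of_rat_dense[of "a i - d" "a i"] d by auto
  then obtain q where q: "\<And>i. a i - d < of_rat (q i)" "\<And>i. of_rat (q i) < a i" by metis
  show thesis
  proof (rule that[of "map q [0..<Suc n]"])
    fix t assume t: "t \<in> {0..real N}"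
    have *: "rat_poly (map q [0..<Suc n]) t = (\<Sum>i\<le>n. of_rat (q i) * t ^ i)"
      unfolding rat_poly_def lessThan_Suc_atMost[symmetric]
      by (intro sum.cong) (auto simp: nth_append simp del: upt_Suc)
    have "\<bar>rat_poly (map q [0..<Suc n]) t - g t\<bar> = \<bar>\<Sum>i\<le>n. (of_rat (q i) - a i) * t ^ i\<bar>"
      unfolding * an by (simp add: sum_subtractf algebra_simps)
    also have "\<dots> \<le> (\<Sum>i\<le>n. d * real N ^ i)"
    proof (rule order_trans[OF sum_abs], rule sum_mono)
      fix i
      have "\<bar>of_rat (q i) - a i\<bar> \<le> d" using q[of i] by linarith
      moreover have "\<bar>t ^ i\<bar> \<le> real N ^ i" using t by (simp add: power_mono)
      ultimately show "\<bar>(of_rat (q i) - a i) * t ^ i\<bar> \<le> d * real N ^ i"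
        unfolding abs_mult using d by (intro mult_mono) auto
    qed
    also have "\<dots> = d * C" by (simp add: C_def sum_distrib_left)
    also have "\<dots> \<le> e / 2" using C e by (simp add: d_def field_simps)
    finally show "\<bar>rat_poly (map q [0..<Suc n]) t - f t\<bar> < e" using g(2)[OF t] by linarith
  qed
qed

text \<open>An open set is a countable union of closed balls \<open>B\<close> around rational
  polynomials. Membership in such a ball is tested at dyadic times only, hence is a countable
  conjunction of conditions on the measurable variables \<open>X t\<close>.\<close>

lemma sample_path_measurable:
  assumes meas: "\<And>t. 0 \<le> t \<Longrightarrow> X t \<in> borel_measurable M"
    and cont: "\<And>\<omega>. \<omega> \<in> space M \<Longrightarrow> continuous_on {0..} (\<lambda>t. X t \<omega>)"
  shows "sample_path X \<in> measurable M borel"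
proof (rule borel_measurableI)
  fix U :: "cpath set" assume U: "open U"
  define B where "B qs N k = {x. \<forall>i l. real i / 2 ^ l \<le> real N \<longrightarrow>
      \<bar>Rep_cpath x (real i / 2 ^ l) - rat_poly qs (real i / 2 ^ l)\<bar> \<le> 1 / real (Suc k)}"
    for qs and N k :: nat
  define J where "J = {(qs, N, k). B qs N k \<subseteq> U}"
  have U_eq: "U = (\<Union>(qs, N, k)\<in>J. B qs N k)"
  proof (intro set_eqI iffI)
    fix x assume "x \<in> U"
    then obtain N e where e: "0 < e"
      "\<And>y. (\<And>t. t \<in> {0..real N} \<Longrightarrow> \<bar>Rep_cpath y t - Rep_cpath x t\<bar> < e) \<Longrightarrow> y \<in> U"
      using open_cpathE[OF U] by metis
    \<comment> \<open>Two radii of this size, from \<open>y\<close> to the polynomial and from there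
      to \<open>x\<close>, add up to less than \<open>e\<close>.\<close>
    obtain k :: nat where k: "1 / real (Suc k) < e / 2"
      using nat_approx_posE[of "e / 2"] e(1) by auto
    obtain qs where qs: "\<And>t. t \<in> {0..real N} \<Longrightarrow> \<bar>rat_poly qs t - Rep_cpath x t\<bar> < 1 / real (Suc k)"
      using rat_poly_dense[of N "Rep_cpath x" "1 / real (Suc k)"]
        continuous_on_subset[OF Rep_cpath_continuous[of x]] by auto
    have "x \<in> B qs N k"
      unfolding B_def using qs by (auto simp: abs_minus_commute intro!: less_imp_le)
    moreover have "B qs N k \<subseteq> U"
    proof
      fix y assume y: "y \<in> B qs N k"
      show "y \<in> U"
      proof (rule e(2))
        fix t assume t: "t \<in> {0..real N}"
        \<comment> \<open>The bound is known at dyadic times; \<open>dyadic_floor l t\<close> stays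
          in the window and tends to \<open>t\<close>.\<close>
        have "(\<lambda>l. \<bar>Rep_cpath y (dyadic_floor l t) - rat_poly qs (dyadic_floor l t)\<bar>)
            \<longlonglongrightarrow> \<bar>Rep_cpath y t - rat_poly qs t\<bar>"
          using t by (intro continuous_dyadic_floor_tendsto continuous_intros Rep_cpath_continuous)
            (auto simp: rat_poly_def intro!: continuous_intros)
        then have "\<bar>Rep_cpath y t - rat_poly qs t\<bar> \<le> 1 / real (Suc k)"
        proof (rule LIMSEQ_le_const2, intro exI allI impI)
          fix l
          have "dyadic_floor l t \<le> real N" using dyadic_floor_le[of t l] t by auto
          then show "\<bar>Rep_cpath y (dyadic_floor l t) - rat_poly qs (dyadic_floor l t)\<bar>
              \<le> 1 / real (Suc k)"
            using y unfolding B_def dyadic_floor_def by blast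
        qed
        then show "\<bar>Rep_cpath y t - Rep_cpath x t\<bar> < e"
          using qs[OF t] k by linarith
      qed
    qed
    ultimately show "x \<in> (\<Union>(qs, N, k)\<in>J. B qs N k)" by (auto simp: J_def)
  qed (auto simp: J_def)
  have "sample_path X -` B qs N k \<inter> space M \<in> sets M" for qs N k
  proof -
    have "sample_path X -` B qs N k \<inter> space M = {\<omega>\<in>space M. \<forall>i l. real i / 2 ^ l \<le> real N \<longrightarrow>
      \<bar>X (real i / 2 ^ l) \<omega> - rat_poly qs (real i / 2 ^ l)\<bar> \<le> 1 / real (Suc k)}"
      using cont by (auto simp: B_def sample_path_def Rep_cpath_Abs_restrict)
    moreover have "X (real i / 2 ^ l) \<in> borel_measurable M" for i l
      by (rule meas) simp
    ultimately show ?thesis by simp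
  qed
  then have "(\<Union>(qs, N, k)\<in>J. sample_path X -` B qs N k \<inter> space M) \<in> sets M"
    by (intro sets.countable_UN'') auto
  moreover have "sample_path X -` U \<inter> space M =
      (\<Union>(qs, N, k)\<in>J. sample_path X -` B qs N k \<inter> space M)"
    by (subst U_eq) auto
  ultimately show "sample_path X -` U \<inter> space M \<in> sets M" by simp
qed

subsection \<open>Compact sets of paths\<close>

lemma continuous_on_Rep_cpath:
  assumes t: "0 \<le> t"
  shows "continuous_on S (\<lambda>x. Rep_cpath x t)"
proof -
  have "open ((\<lambda>x. Rep_cpath x t) -` W)" if W: "open W" for W
    unfolding open_cpath_def
  proof
    fix x assume "x \<in> (\<lambda>x. Rep_cpath x t) -` W"
    then obtain e where "0 < e" "\<And>y. dist y (Rep_cpath x t) < e \<Longrightarrow> y \<in> W"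
      using W by (auto simp: open_dist)
    then show "\<exists>K e. compact K \<and> K \<subseteq> {0..} \<and> 0 < e \<and>
        (\<forall>y. (\<forall>u\<in>K. dist (Rep_cpath y u) (Rep_cpath x u) < e) \<longrightarrow> y \<in> (\<lambda>x. Rep_cpath x t) -` W)"
      using t by (intro exI[of _ "{t}"] exI[of _ e]) auto
  qed
  then have "continuous_on UNIV (\<lambda>x. Rep_cpath x t)"
    by (simp add: continuous_on_open_vimage)
  then show ?thesis by (rule continuous_on_subset) simp
qed

lemma cpath_eqI:
  assumes "\<And>t. 0 \<le> t \<Longrightarrow> Rep_cpath x t = Rep_cpath y t"
  shows "x = y"
proof -
  have "Rep_cpath x = Rep_cpath y"
    using Rep_cpath[of x] Rep_cpath[of y] assms by (intro extensionalityI[of _ "{0..}"]) auto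
  then show ?thesis by (simp add: Rep_cpath_inject)
qed

text \<open>Distinct paths differ at some time, and evaluation there separates them. Compact sets of
  paths thereby become Borel.\<close>

instance cpath :: t2_space
proof
  fix x y :: cpath assume "x \<noteq> y"
  then obtain t where t: "0 \<le> t" "Rep_cpath x t \<noteq> Rep_cpath y t" using cpath_eqI by blast
  then obtain U V where "open U" "open V" "Rep_cpath x t \<in> U" "Rep_cpath y t \<in> V" "U \<inter> V = {}"
    using hausdorff[OF t(2)] by blast
  moreover have "open ((\<lambda>z. Rep_cpath z t) -` W)" if "open W" for W
    using that t(1) by (intro open_vimage continuous_on_Rep_cpath)
  ultimately show "\<exists>U V. open U \<and> open V \<and> x \<in> U \<and> y \<in> V \<and> U \<inter> V = {}"
    by (intro exI[of _ "(\<lambda>z. Rep_cpath z t) -` U"] exI[of _ "(\<lambda>z. Rep_cpath z t) -` V"]) auto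
qed

text \<open>An Arzela-Ascoli class: pinned at 0 and equicontinuous, with \<open>w j\<close> bounding
  the oscillation at scale 2^-j on the window [0, j]. It consists of functions rather than paths, so
  that Tychonoff's theorem applies.\<close>

definition modulus_set :: "(nat \<Rightarrow> real) \<Rightarrow> nat \<Rightarrow> (real \<Rightarrow> real) set" where
  "modulus_set w m = {f \<in> extensional {0..}. f 0 = 0 \<and>
     (\<forall>j\<ge>m. \<forall>s\<in>{0..real j}. \<forall>t\<in>{0..real j}. \<bar>s - t\<bar> \<le> 1 / 2 ^ j \<longrightarrow> \<bar>f s - f t\<bar> \<le> w j)}"

lemma modulus_setD:
  assumes "f \<in> modulus_set w m" "m \<le> j" "s \<in> {0..real j}" "t \<in> {0..real j}" "\<bar>s - t\<bar> \<le> 1 / 2 ^ j"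
  shows "\<bar>f s - f t\<bar> \<le> w j"
  using assms unfolding modulus_set_def by blast

text \<open>Walk from \<open>t\<close> down to 0 in \<open>n\<close> steps of length at most 2^-j;
  each step costs at most \<open>w j\<close>.\<close>

lemma modulus_set_bound:
  assumes f: "f \<in> modulus_set w m" and j: "m \<le> j"
  shows "0 \<le> t \<Longrightarrow> t \<le> real j \<Longrightarrow> t \<le> real n / 2 ^ j \<Longrightarrow> \<bar>f t\<bar> \<le> real n * w j"
proof (induction n arbitrary: t)
  case 0
  then show ?case using f by (simp add: modulus_set_def)
next
  case (Suc n)
  define s where "s = max 0 (t - 1 / 2 ^ j)"
  have "t - 1 / 2 ^ j \<le> t" by simp
  then have sj: "s \<le> real j" using Suc.prems unfolding s_def by linarith
  have "\<bar>f s\<bar> \<le> real n * w j"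
  proof (rule Suc.IH)
    have "t - 1 / 2 ^ j \<le> real n / 2 ^ j"
      using Suc.prems(3) by (simp add: add_divide_distrib)
    then show "s \<le> real n / 2 ^ j" by (simp add: s_def)
  qed (use sj in \<open>simp_all add: s_def\<close>)
  moreover have "\<bar>f t - f s\<bar> \<le> w j"
    by (rule modulus_setD[OF f j]) (use Suc.prems sj in \<open>auto simp: s_def max_def\<close>)
  ultimately show ?case by (simp add: algebra_simps)
qed

text \<open>Tychonoff: the class lies in a product of compact intervals, with the singleton
  \<open>{undefined}\<close> at negative times, and is closed there because every constraint is a
  closed condition on at most two coordinates.\<close>

lemma compact_modulus_set: "compact (modulus_set w m)"
proof -
  define j where "j t = max m (nat \<lceil>t\<rceil>)" for t :: real
  define b where "b t = real (nat \<lceil>t * 2 ^ j t\<rceil>) * w (j t)" for t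
  define P where "P = PiE (UNIV :: real set)
     (\<lambda>t. if 0 \<le> t then {- b t..b t} else {undefined :: real})"
  have "compactin (product_topology (\<lambda>_. euclidean) UNIV) P"
    unfolding P_def compactin_PiE by auto
  then have P: "compact P"
    by (simp add: euclidean_product_topology)
  have sub: "modulus_set w m \<subseteq> P"
  proof
    fix f assume f: "f \<in> modulus_set w m"
    have "\<bar>f t\<bar> \<le> b t" if "0 \<le> t" for t
      unfolding b_def
    proof (rule modulus_set_bound[OF f])
      show "m \<le> j t" by (simp add: j_def)
      show "t \<le> real (j t)" unfolding j_def by linarith
      have "t * 2 ^ j t \<le> real (nat \<lceil>t * 2 ^ j t\<rceil>)" by linarith
      then show "t \<le> real (nat \<lceil>t * 2 ^ j t\<rceil>) / 2 ^ j t" by (simp add: field_simps)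
    qed fact
    then have "- b t \<le> f t \<and> f t \<le> b t" if "0 \<le> t" for t
      using that by (metis abs_le_iff minus_le_iff)
    moreover have "f t = undefined" if "\<not> 0 \<le> t" for t
      using f that by (auto simp: modulus_set_def extensional_def)
    ultimately show "f \<in> P" by (auto simp: P_def)
  qed
  have "closed (modulus_set w m)"
    unfolding modulus_set_def extensional_def mem_Collect_eq Ball_def
    by (intro closed_Collect_conj closed_Collect_all closed_Collect_imp open_Collect_const
        closed_Collect_eq closed_Collect_le continuous_intros continuous_on_product_coordinates)
  with P sub show ?thesis
    by (metis closed_Int_compact inf.absorb_iff1)
qed

lemma modulus_set_continuous:
  assumes f: "f \<in> modulus_set w m" and w: "w \<longlonglongrightarrow> 0"
  shows "continuous_on {0..} f"
  unfolding continuous_on_iff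
proof (intro ballI allI impI)
  fix t e :: real assume t: "t \<in> {0..}" and e: "0 < e"
  have "\<forall>\<^sub>F j in sequentially. w j < e" using w e by (rule order_tendstoD)
  \<comment> \<open>One unit of room beyond \<open>t\<close>, so that every \<open>s\<close> within
    2^-j of \<open>t\<close> is still in the window.\<close>
  moreover have "\<forall>\<^sub>F j in sequentially. m \<le> j \<and> nat \<lceil>t + 1\<rceil> \<le> j"
    by (intro eventually_conj eventually_ge_at_top)
  ultimately have "\<forall>\<^sub>F j in sequentially. w j < e \<and> m \<le> j \<and> nat \<lceil>t + 1\<rceil> \<le> j"
    by (rule eventually_conj)
  then obtain j where j: "w j < e" "m \<le> j" "nat \<lceil>t + 1\<rceil> \<le> j"
    by (auto dest: eventually_happens)
  have tj: "t + 1 \<le> real j" using j(3) by linarith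
  show "\<exists>d>0. \<forall>s\<in>{0..}. dist s t < d \<longrightarrow> dist (f s) (f t) < e"
  proof (intro exI[of _ "1 / 2 ^ j"] conjI ballI impI)
    fix s :: real assume s: "s \<in> {0..}" "dist s t < 1 / 2 ^ j"
    have "1 / 2 ^ j \<le> (1 :: real)" by simp
    then have "s \<le> real j" using s tj unfolding dist_real_def by linarith
    then have "\<bar>f s - f t\<bar> \<le> w j"
      using s t tj by (intro modulus_setD[OF f j(2)]) (auto simp: dist_real_def)
    then show "dist (f s) (f t) < e" using j(1) by (simp add: dist_real_def)
  qed simp
qed

text \<open>On an equicontinuous class, closeness at finitely many grid points is uniform closeness
  on a window. Compactness in the product topology thereby carries over to paths.\<close>

lemma continuous_on_Abs_cpath:
  assumes w: "w \<longlonglongrightarrow> 0"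
  shows "continuous_on (modulus_set w m) Abs_cpath"
  unfolding continuous_on_topological
proof (intro ballI allI impI)
  fix f U assume f: "f \<in> modulus_set w m" and U: "open U" "Abs_cpath f \<in> U"
  have Rep: "Rep_cpath (Abs_cpath g) = g" if "g \<in> modulus_set w m" for g
    using modulus_set_continuous[OF that w] that
    by (intro Abs_cpath_inverse) (auto simp: modulus_set_def)
  obtain N e where e: "0 < e"
    "\<And>y. (\<And>t. t \<in> {0..real N} \<Longrightarrow> \<bar>Rep_cpath y t - f t\<bar> < e) \<Longrightarrow> y \<in> U"
    using open_cpathE[OF U] Rep[OF f] by metis
  have "\<forall>\<^sub>F j in sequentially. w j < e / 4" using w e by (intro order_tendstoD) auto
  moreover have "\<forall>\<^sub>F j in sequentially. m \<le> j \<and> N \<le> j"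
    by (intro eventually_conj eventually_ge_at_top)
  ultimately have "\<forall>\<^sub>F j in sequentially. w j < e / 4 \<and> m \<le> j \<and> N \<le> j"
    by (rule eventually_conj)
  then obtain j where j: "w j < e / 4" "m \<le> j" "N \<le> j"
    by (auto dest: eventually_happens)
  \<comment> \<open>The grid points with index at most \<open>N * 2 ^ j\<close> cover the window.
    The error splits into two oscillations and one grid difference, each below
    \<open>e / 4\<close>.\<close>
  define V where "V = (\<Inter>i\<in>{..N * 2 ^ j}. (\<lambda>g :: real \<Rightarrow> real. g (real i / 2 ^ j)) -`
      ball (f (real i / 2 ^ j)) (e / 4))"
  show "\<exists>V. open V \<and> f \<in> V \<and> (\<forall>g\<in>modulus_set w m. g \<in> V \<longrightarrow> Abs_cpath g \<in> U)"
  proof (intro exI[of _ V] conjI ballI impI)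
    show "open V" unfolding V_def
      by (intro open_INT ballI open_vimage continuous_on_product_coordinates) auto
    show "f \<in> V" using e by (simp add: V_def)
    fix g assume g: "g \<in> modulus_set w m" "g \<in> V"
    show "Abs_cpath g \<in> U"
    proof (rule e(2))
      fix t assume t: "t \<in> {0..real N}"
      define s where "s = dyadic_floor j t"
      have s: "0 \<le> s" "s \<le> t" "t - s \<le> 1 / 2 ^ j"
        using dyadic_floor_nonneg[of j t] dyadic_floor_le[of t j] dyadic_floor_gt[of t j] t
        by (auto simp: s_def)
      have "\<bar>h s - h t\<bar> \<le> w j" if "h \<in> modulus_set w m" for h
        using s t j(3) by (intro modulus_setD[OF that j(2)]) auto
      from this[OF f] this[OF g(1)] have mod: "\<bar>f s - f t\<bar> \<le> w j" "\<bar>g s - g t\<bar> \<le> w j" .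
      have "nat \<lfloor>2 ^ j * t\<rfloor> \<le> N * 2 ^ j"
      proof -
        have "2 ^ j * t \<le> real (N * 2 ^ j)" using t by simp
        then show ?thesis by linarith
      qed
      then have "\<bar>f s - g s\<bar> < e / 4"
        using g(2) unfolding V_def s_def dyadic_floor_def by (auto simp: dist_real_def)
      with mod have "\<bar>g t - f t\<bar> < e" using j(1) by linarith
      then show "\<bar>Rep_cpath (Abs_cpath g) t - f t\<bar> < e" by (simp add: Rep[OF g(1)])
    qed
  qed
qed

subsection \<open>Trigonometric functionals and weak convergence\<close>

text \<open>Real-valued characteristic functionals. The phase \<open>b\<close> provides sines, and
  the empty \<open>I\<close> constants, so that the class is an algebra.\<close>

inductive trig_sum :: "(cpath \<Rightarrow> real) \<Rightarrow> bool" where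
  cos: "finite I \<Longrightarrow> I \<subseteq> {0..} \<Longrightarrow> trig_sum (\<lambda>x. c * cos ((\<Sum>t\<in>I. a t * Rep_cpath x t) + b))"
| add: "trig_sum f \<Longrightarrow> trig_sum g \<Longrightarrow> trig_sum (\<lambda>x. f x + g x)"

lemma trig_sum_const: "trig_sum (\<lambda>x. c)"
  using trig_sum.cos[of "{}" c "\<lambda>_. 0" 0] by simp

lemma trig_sum_continuous: "trig_sum f \<Longrightarrow> continuous_on S f"
  by (induction rule: trig_sum.induct)
    (auto intro!: continuous_intros continuous_on_Rep_cpath)

lemma trig_sum_bounded: "trig_sum f \<Longrightarrow> \<exists>H. \<forall>x. \<bar>f x\<bar> \<le> H"
proof (induction rule: trig_sum.induct)
  case (cos I c a b)
  show ?case
    by (intro exI[of _ "\<bar>c\<bar>"]) (simp add: abs_mult mult_left_le)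
next
  case (add f g)
  then obtain F G where "\<forall>x. \<bar>f x\<bar> \<le> F" "\<forall>x. \<bar>g x\<bar> \<le> G" by blast
  then show ?case
    by (intro exI[of _ "F + G"]) (meson abs_triangle_ineq add_mono order_trans)
qed

lemma sum_combine_Un:
  fixes f :: "'a \<Rightarrow> real"
  assumes "finite I" "finite J"
  shows "(\<Sum>t\<in>I. a t * f t) + k * (\<Sum>t\<in>J. a' t * f t) =
    (\<Sum>t\<in>I \<union> J. ((if t \<in> I then a t else 0) + k * (if t \<in> J then a' t else 0)) * f t)"
proof -
  have "(\<Sum>t\<in>I. a t * f t) = (\<Sum>t\<in>I \<union> J. (if t \<in> I then a t else 0) * f t)"
    using assms by (intro sum.mono_neutral_cong_left) auto
  moreover have "(\<Sum>t\<in>J. a' t * f t) = (\<Sum>t\<in>I \<union> J. (if t \<in> J then a' t else 0) * f t)"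
    using assms by (intro sum.mono_neutral_cong_left) auto
  ultimately show ?thesis
    by (simp add: sum_distrib_left sum.distrib algebra_simps)
qed

text \<open>Product-to-sum: the product of two cosines is half the sum of the cosines of the sum and
  the difference of the arguments, whose coefficients are \<open>d 1\<close> and
  \<open>d (- 1)\<close>.\<close>

lemma trig_sum_mult_cos:
  assumes g: "trig_sum g" and I: "finite I" "I \<subseteq> {0..}"
  shows "trig_sum (\<lambda>x. (c * cos ((\<Sum>t\<in>I. a t * Rep_cpath x t) + b)) * g x)"
  using g
proof induction
  case (cos J c' a' b')
  define d where "d k t = (if t \<in> I then a t else 0) + k * (if t \<in> J then a' t else 0)" for k t
  have "trig_sum (\<lambda>x. c * c' / 2 * cos ((\<Sum>t\<in>I \<union> J. d 1 t * Rep_cpath x t) + (b + b')) +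
      c * c' / 2 * cos ((\<Sum>t\<in>I \<union> J. d (- 1) t * Rep_cpath x t) + (b - b')))"
    by (intro trig_sum.intros) (use I cos in auto)
  moreover have "c * c' / 2 * cos ((\<Sum>t\<in>I \<union> J. d 1 t * Rep_cpath x t) + (b + b')) +
      c * c' / 2 * cos ((\<Sum>t\<in>I \<union> J. d (- 1) t * Rep_cpath x t) + (b - b')) =
    (c * cos ((\<Sum>t\<in>I. a t * Rep_cpath x t) + b)) * (c' * cos ((\<Sum>t\<in>J. a' t * Rep_cpath x t) + b'))"
    for x
  proof -
    define L L' where "L = (\<Sum>t\<in>I. a t * Rep_cpath x t)" and "L' = (\<Sum>t\<in>J. a' t * Rep_cpath x t)"
    have d: "(\<Sum>t\<in>I \<union> J. d k t * Rep_cpath x t) = L + k * L'" for k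
      using sum_combine_Un[OF I(1) cos(1), of a "Rep_cpath x" k a'] by (simp add: L_def L'_def d_def)
    have args: "(L + 1 * L') + (b + b') = (L + b) + (L' + b')"
      "(L + (- 1) * L') + (b - b') = (L + b) - (L' + b')"
      by simp_all
    have cos_sum: "cos ((L + 1 * L') + (b + b')) + cos ((L + (- 1) * L') + (b - b')) =
        2 * (cos (L + b) * cos (L' + b'))"
      unfolding args cos_times_cos by simp
    show ?thesis
      unfolding d L_def[symmetric] L'_def[symmetric] distrib_left[symmetric] cos_sum by simp
  qed
  ultimately show ?case by simp
next
  case (add f g)
  then show ?case by (simp only: distrib_left) (rule trig_sum.add)
qed

lemma trig_sum_mult:
  assumes "trig_sum f" "trig_sum g"
  shows "trig_sum (\<lambda>x. f x * g x)"
  using assms(1)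
proof induction
  case (cos I c a b)
  then show ?case using assms(2) by (intro trig_sum_mult_cos)
next
  case (add f h)
  then show ?case by (simp only: distrib_right) (rule trig_sum.add)
qed

lemma trig_sum_polynomial:
  assumes "real_polynomial_function q" "trig_sum h"
  shows "trig_sum (\<lambda>x. q (h x))"
  using assms(1)
proof induction
  case (linear f)
  then interpret bounded_linear f .
  have "f (h x) = h x * f 1" for x using scaleR[of "h x" 1] by simp
  then show ?case using trig_sum_mult[OF assms(2) trig_sum_const] by simp
qed (auto intro: trig_sum_const trig_sum.add trig_sum_mult)

lemma trig_sum_Stone_Weierstrass:
  assumes K: "compact K" and f: "continuous_on K f" and e: "0 < e"
  obtains h where "trig_sum h" "\<And>x. x \<in> K \<Longrightarrow> \<bar>f x - h x\<bar> < e"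
proof -
  interpret function_ring_on "Collect trig_sum" K
  proof
    fix x y :: cpath assume "x \<noteq> y"
    then obtain t where t: "0 \<le> t" "Rep_cpath x t \<noteq> Rep_cpath y t" using cpath_eqI by blast
    \<comment> \<open>Chosen to make the phase 0 at \<open>x\<close> and pi at \<open>y\<close>,
      where the cosine takes the values 1 and -1.\<close>
    define k b where "k = pi / (Rep_cpath y t - Rep_cpath x t)" and "b = - (k * Rep_cpath x t)"
    have "k * (Rep_cpath y t - Rep_cpath x t) = pi"
      using t(2) by (simp add: k_def)
    then have "k * Rep_cpath y t + b = pi"
      by (simp add: b_def right_diff_distrib)
    then have "cos (k * Rep_cpath x t + b) \<noteq> cos (k * Rep_cpath y t + b)"
      by (simp add: b_def)
    moreover have "trig_sum (\<lambda>z. cos (k * Rep_cpath z t + b))"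
      using trig_sum.cos[of "{t}" 1 "\<lambda>_. k" b] t(1) by simp
    ultimately show "\<exists>f\<in>Collect trig_sum. f x \<noteq> f y"
      by (intro bexI[of _ "\<lambda>z. cos (k * Rep_cpath z t + b)"]) auto
  qed (use K in \<open>auto intro: trig_sum_continuous trig_sum.add trig_sum_mult trig_sum_const\<close>)
  show thesis using Stone_Weierstrass_basic[OF f e] that by blast
qed

text \<open>Composing with a polynomial that imitates truncation at level \<open>B\<close> turns an approximation on
  \<open>K\<close> into one that is moreover bounded off \<open>K\<close>, independently of its accuracy.\<close>

lemma trig_sum_approx:
  assumes K: "compact K" and f: "continuous_on K f" "\<And>x. \<bar>f x\<bar> \<le> B" and e: "0 < e"
  obtains h where "trig_sum h" "\<And>x. x \<in> K \<Longrightarrow> \<bar>f x - h x\<bar> \<le> e" "\<And>x. \<bar>h x\<bar> \<le> B + e"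
proof -
  have B: "0 \<le> B" using f(2)[of undefined] by linarith
  obtain h where h: "trig_sum h" "\<And>x. x \<in> K \<Longrightarrow> \<bar>f x - h x\<bar> < e / 2"
    using trig_sum_Stone_Weierstrass[OF K f(1), of "e / 2"] e by auto
  obtain H where H: "\<And>x. \<bar>h x\<bar> \<le> H" using trig_sum_bounded[OF h(1)] by blast
  define c where "c u = max (- B) (min B u)" for u :: real
  have "continuous_on {- H..H} c" unfolding c_def by (intro continuous_intros)
  then obtain q where q: "real_polynomial_function q" "\<And>u. u \<in> {- H..H} \<Longrightarrow> \<bar>c u - q u\<bar> < e / 2"
    using Stone_Weierstrass_real_polynomial_function[of "{- H..H}" c "e / 2"] e by auto
  have qh: "\<bar>c (h x) - q (h x)\<bar> < e / 2" for x
    using H[of x] by (intro q(2)) auto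
  show thesis
  proof
    show "trig_sum (\<lambda>x. q (h x))" using q(1) h(1) by (rule trig_sum_polynomial)
    \<comment> \<open>Clamping to [-B, B] cannot increase the distance to \<open>f x\<close>, which
      already lies in that interval.\<close>
    show "\<bar>f x - q (h x)\<bar> \<le> e" if "x \<in> K" for x
      using qh[of x] h(2)[OF that] f(2)[of x] unfolding c_def by linarith
    show "\<bar>q (h x)\<bar> \<le> B + e" for x
      using qh[of x] B e unfolding c_def by linarith
  qed
qed

text \<open>On \<open>K\<close> the integrands differ by at most \<open>e\<close>; off
  \<open>K\<close> by at most \<open>B + C\<close>, on a set of mass at most
  \<open>d\<close>.\<close>

lemma integral_approx_on_compact:
  fixes f h :: "'b :: t2_space \<Rightarrow> real"
  assumes N: "prob_space N" "sets N = sets borel" and K: "compact K" "measure N (- K) \<le> d"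
    and f: "f \<in> borel_measurable borel" "\<And>x. \<bar>f x\<bar> \<le> B"
    and h: "h \<in> borel_measurable borel" "\<And>x. \<bar>h x\<bar> \<le> C"
    and fh: "\<And>x. x \<in> K \<Longrightarrow> \<bar>f x - h x\<bar> \<le> e" and e: "0 \<le> e"
  shows "\<bar>(\<integral>x. f x \<partial>N) - (\<integral>x. h x \<partial>N)\<bar> \<le> e + (B + C) * d"
proof -
  interpret prob_space N by fact
  have [simp]: "- K \<in> sets N" using N(2) borel_compact[OF K(1)] by auto
  have [simp]: "- K \<inter> space N = - K" using sets_eq_imp_space_eq[OF N(2)] by simp
  have [measurable]: "f \<in> borel_measurable N" "h \<in> borel_measurable N"
    using f(1) h(1) measurable_cong_sets[OF N(2) refl] by auto
  have int: "integrable N f" "integrable N h"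
    using f(2) h(2)
    by (auto intro: integrable_const_bound[where B = B] integrable_const_bound[where B = C])
  have BC: "0 \<le> B + C" using f(2)[of undefined] h(2)[of undefined] by linarith
  have "\<bar>f x - h x\<bar> \<le> e + (B + C) * indicator (- K) x" for x
    using fh[of x] f(2)[of x] h(2)[of x] e by (auto simp: indicator_def)
  then have "(\<integral>x. \<bar>f x - h x\<bar> \<partial>N) \<le> (\<integral>x. e + (B + C) * indicator (- K) x \<partial>N)"
    using int by (intro integral_mono) (auto simp: less_top[symmetric] emeasure_eq_measure)
  also have "\<dots> = e + (B + C) * measure N (- K)"
    by (simp add: prob_space less_top[symmetric] emeasure_eq_measure)
  also have "\<dots> \<le> e + (B + C) * d"
    using K(2) BC by (intro add_left_mono mult_left_mono)
  finally have "(\<integral>x. \<bar>f x - h x\<bar> \<partial>N) \<le> e + (B + C) * d" .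
  moreover have "\<bar>\<integral>x. f x - h x \<partial>N\<bar> \<le> (\<integral>x. \<bar>f x - h x\<bar> \<partial>N)"
    by (rule integral_abs_bound)
  ultimately show ?thesis using int by simp
qed

lemma tendsto_integral_trig_sum:
  assumes ev: "\<forall>\<^sub>F i in F. prob_space (\<mu> i) \<and> sets (\<mu> i) = sets borel"
    and \<nu>: "prob_space \<nu>" "sets \<nu> = sets borel"
    and fidi: "\<And>I a b. finite I \<Longrightarrow> I \<subseteq> {0..} \<Longrightarrow>
      ((\<lambda>i. \<integral>x. cos ((\<Sum>t\<in>I. a t * Rep_cpath x t) + b) \<partial>\<mu> i) \<longlongrightarrow>
        (\<integral>x. cos ((\<Sum>t\<in>I. a t * Rep_cpath x t) + b) \<partial>\<nu>)) F"
    and f: "trig_sum f"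
  shows "((\<lambda>i. \<integral>x. f x \<partial>\<mu> i) \<longlongrightarrow> (\<integral>x. f x \<partial>\<nu>)) F"
  using f
proof induction
  case (cos I c a b)
  then show ?case using fidi[of I a b] by (auto intro!: tendsto_intros)
next
  case (add f g)
  have int: "integrable N h" if N: "prob_space N" "sets N = sets borel" and h: "trig_sum h"
    for N :: "cpath measure" and h
  proof -
    interpret prob_space N by fact
    obtain H where H: "\<forall>x. \<bar>h x\<bar> \<le> H" using trig_sum_bounded[OF h] by blast
    have "h \<in> borel_measurable N"
      using borel_measurable_continuous_onI[OF trig_sum_continuous[OF h]]
        measurable_cong_sets[OF N(2) refl] by auto
    with H show ?thesis by (intro integrable_const_bound[where B = H]) auto
  qed
  have "((\<lambda>i. (\<integral>x. f x \<partial>\<mu> i) + (\<integral>x. g x \<partial>\<mu> i)) \<longlongrightarrow> (\<integral>x. f x \<partial>\<nu>) + (\<integral>x. g x \<partial>\<nu>)) F"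
    using add by (intro tendsto_add)
  \<comment> \<open>Splitting the integral needs integrability, which is available once
    \<open>\<mu> i\<close> is a Borel probability measure.\<close>
  moreover have "\<forall>\<^sub>F i in F. (\<integral>x. f x \<partial>\<mu> i) + (\<integral>x. g x \<partial>\<mu> i) = (\<integral>x. f x + g x \<partial>\<mu> i)"
    using ev by eventually_elim (use add int in simp)
  ultimately show ?case
    using add int[OF \<nu>] by (auto dest: Lim_transform_eventually)
qed

text \<open>First \<open>K\<close> is chosen by tightness, then \<open>h\<close> approximating on
  \<open>K\<close>. The bound on \<open>h\<close> does not grow with \<open>K\<close>, so the mass
  off \<open>K\<close> stays harmless.\<close>

theorem weakly_converges_cpathI:
  fixes \<mu> :: "'i \<Rightarrow> cpath measure"
  assumes ev: "\<forall>\<^sub>F i in F. prob_space (\<mu> i) \<and> sets (\<mu> i) = sets borel"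
    and \<nu>: "prob_space \<nu>" "sets \<nu> = sets borel"
    and fidi: "\<And>I a b. finite I \<Longrightarrow> I \<subseteq> {0..} \<Longrightarrow>
      ((\<lambda>i. \<integral>x. cos ((\<Sum>t\<in>I. a t * Rep_cpath x t) + b) \<partial>\<mu> i) \<longlongrightarrow>
        (\<integral>x. cos ((\<Sum>t\<in>I. a t * Rep_cpath x t) + b) \<partial>\<nu>)) F"
    and tight: "\<And>d. 0 < d \<Longrightarrow>
      \<exists>K. compact K \<and> measure \<nu> (- K) \<le> d \<and> (\<forall>\<^sub>F i in F. measure (\<mu> i) (- K) \<le> d)"
  shows "weakly_converges \<mu> \<nu> F"
  unfolding weakly_converges_def
proof (intro conjI allI impI ev \<nu>)
  fix \<phi> :: "cpath \<Rightarrow> real"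
  assume \<phi>: "continuous_on UNIV \<phi> \<and> bounded (range \<phi>)"
  then obtain B where B: "\<And>x. \<bar>\<phi> x\<bar> \<le> B" by (auto simp: bounded_iff)
  have B0: "0 \<le> B" using B[of undefined] by linarith
  show "((\<lambda>i. \<integral>x. \<phi> x \<partial>\<mu> i) \<longlongrightarrow> (\<integral>x. \<phi> x \<partial>\<nu>)) F"
  proof (rule tendstoI)
    fix e :: real assume e: "0 < e"
    \<comment> \<open>The final error is below \<open>(4 * B + 5) * d\<close>: two approximations of
      size \<open>d + (2 * B + 1) * d\<close> and one \<open>d\<close> for \<open>h\<close>. The cap
      at 1 turns \<open>B + d\<close> into \<open>B + 1\<close>.\<close>
    define d where "d = min 1 (e / (2 * (2 * B + 2) + 2))"
    have d: "0 < d" "d \<le> 1" using e B0 by (auto simp: d_def)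
    have "d \<le> e / (2 * (2 * B + 2) + 2)" by (simp add: d_def)
    then have de: "2 * (d + (B + (B + 1)) * d) + d < e"
      using B0 d e by (simp add: field_simps)
    obtain K where K: "compact K" "measure \<nu> (- K) \<le> d" "\<forall>\<^sub>F i in F. measure (\<mu> i) (- K) \<le> d"
      using tight[OF d(1)] by auto
    obtain h where h: "trig_sum h" "\<And>x. x \<in> K \<Longrightarrow> \<bar>\<phi> x - h x\<bar> \<le> d" "\<And>x. \<bar>h x\<bar> \<le> B + d"
      using trig_sum_approx[OF K(1) continuous_on_subset[OF conjunct1[OF \<phi>] subset_UNIV] B d(1)] by blast
    have h1: "\<bar>h x\<bar> \<le> B + 1" for x using h(3)[of x] d by linarith
    have meas: "\<phi> \<in> borel_measurable borel" "h \<in> borel_measurable borel"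
      using \<phi> trig_sum_continuous[OF h(1)] by (auto intro: borel_measurable_continuous_onI)
    have near: "\<bar>(\<integral>x. \<phi> x \<partial>N) - (\<integral>x. h x \<partial>N)\<bar> \<le> d + (B + (B + 1)) * d"
      if "prob_space N" "sets N = sets borel" "measure N (- K) \<le> d" for N
      by (rule integral_approx_on_compact[OF that(1,2) K(1) that(3)]) (use meas B h1 h(2) d in auto)
    have "((\<lambda>i. \<integral>x. h x \<partial>\<mu> i) \<longlongrightarrow> (\<integral>x. h x \<partial>\<nu>)) F"
      using ev \<nu> fidi h(1) by (rule tendsto_integral_trig_sum)
    then have "\<forall>\<^sub>F i in F. dist (\<integral>x. h x \<partial>\<mu> i) (\<integral>x. h x \<partial>\<nu>) < d"
      using d(1) by (rule tendstoD)
    with ev K(3) show "\<forall>\<^sub>F i in F. dist (\<integral>x. \<phi> x \<partial>\<mu> i) (\<integral>x. \<phi> x \<partial>\<nu>) < e"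
    proof eventually_elim
      case (elim i)
      then show ?case
        using near[of "\<mu> i"] near[OF \<nu> K(2)] de by (auto simp: dist_real_def)
    qed
  qed
qed

subsection \<open>Tightness from moments of increments\<close>

text \<open>Doubling the resolution turns the numerator \<open>n\<close> into \<open>2 * n\<close>
  or \<open>2 * n + 1\<close>, so the rounded time stays or moves by one cell of the finer
  grid.\<close>

lemma dyadic_floor_Suc:
  assumes "0 \<le> t"
  shows "dyadic_floor (Suc k) t = dyadic_floor k t \<or>
    (\<exists>i. dyadic_floor k t = real i / 2 ^ Suc k \<and> dyadic_floor (Suc k) t = real (Suc i) / 2 ^ Suc k
      \<and> real (Suc i) / 2 ^ Suc k \<le> t)"
proof -
  define n where "n = nat \<lfloor>2 ^ k * t\<rfloor>"
  have n: "real n \<le> 2 ^ k * t" "2 ^ k * t < real n + 1"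
    using assms unfolding n_def by (auto simp: of_nat_nat)
  have floor: "dyadic_floor k t = real (2 * n) / 2 ^ Suc k"
    by (simp add: dyadic_floor_def n_def)
  have "nat \<lfloor>2 ^ Suc k * t\<rfloor> = 2 * n \<or> nat \<lfloor>2 ^ Suc k * t\<rfloor> = Suc (2 * n)"
  proof -
    have "real (2 * n) \<le> 2 ^ Suc k * t" "2 ^ Suc k * t < real (2 * n) + 2" using n by auto
    then show ?thesis by linarith
  qed
  then show ?thesis
  proof
    assume "nat \<lfloor>2 ^ Suc k * t\<rfloor> = 2 * n"
    then show ?thesis using floor by (simp add: dyadic_floor_def)
  next
    assume "nat \<lfloor>2 ^ Suc k * t\<rfloor> = Suc (2 * n)"
    then have "dyadic_floor (Suc k) t = real (Suc (2 * n)) / 2 ^ Suc k"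
      unfolding dyadic_floor_def by (rule arg_cong)
    then show ?thesis using floor dyadic_floor_le[OF assms, of "Suc k"] by metis
  qed
qed

text \<open>Chaining. The increments at levels above \<open>j\<close> sum to 9 (9/10)^j; two such
  chains and one step at level \<open>j\<close> give 9 + 1 + 9 = 19.\<close>

lemma dyadic_increments_imp_modulus_set:
  fixes f :: "real \<Rightarrow> real"
  assumes cont: "continuous_on {0..} f" and ext: "f \<in> extensional {0..}" and f0: "f 0 = 0"
    and incr: "\<And>l i. m \<le> l \<Longrightarrow> i < l * 2 ^ l \<Longrightarrow>
      \<bar>f (real (Suc i) / 2 ^ l) - f (real i / 2 ^ l)\<bar> \<le> (9 / 10) ^ l"
  shows "f \<in> modulus_set (\<lambda>j. 19 * (9 / 10) ^ j) m"
proof -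
  have incr': "\<bar>f (real (Suc i) / 2 ^ l) - f (real i / 2 ^ l)\<bar> \<le> (9 / 10) ^ l"
    if "m \<le> l" "real (Suc i) / 2 ^ l \<le> real l" for l i
  proof (rule incr[OF that(1)])
    have "real (Suc i) \<le> real (l * 2 ^ l)" using that(2) by (simp add: field_simps)
    then show "i < l * 2 ^ l" by linarith
  qed
  \<comment> \<open>The right side is the exact sum of (9/10)^l over
    \<open>j < l \<le> j + n\<close>, so the induction closes by telescoping.\<close>
  have chain: "\<bar>f (dyadic_floor (j + n) t) - f (dyadic_floor j t)\<bar> \<le> 9 * (9 / 10) ^ j - 9 * (9 / 10) ^ (j + n)"
    if j: "m \<le> j" and t: "0 \<le> t" "t \<le> real j" for j n t
  proof (induction n)
    case (Suc n)
    have "\<bar>f (dyadic_floor (Suc (j + n)) t) - f (dyadic_floor (j + n) t)\<bar> \<le> (9 / 10) ^ Suc (j + n)"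
      using dyadic_floor_Suc[OF t(1), of "j + n"]
    proof (elim disjE exE conjE)
      fix i assume i: "dyadic_floor (j + n) t = real i / 2 ^ Suc (j + n)"
        "dyadic_floor (Suc (j + n)) t = real (Suc i) / 2 ^ Suc (j + n)"
        "real (Suc i) / 2 ^ Suc (j + n) \<le> t"
      have "t \<le> real (Suc (j + n))" using t(2) by simp
      then show ?thesis
        unfolding i(1,2) using j i(3) by (intro incr') linarith+
    qed simp
    moreover have "9 * (9 / 10 :: real) ^ (j + n) = 9 * (9 / 10) ^ (j + Suc n) + (9 / 10) ^ Suc (j + n)"
      by simp
    ultimately show ?case using Suc.IH unfolding add_Suc_right by linarith
  qed simp
  have floor: "\<bar>f t - f (dyadic_floor j t)\<bar> \<le> 9 * (9 / 10) ^ j"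
    if j: "m \<le> j" and t: "0 \<le> t" "t \<le> real j" for j t
  proof (rule LIMSEQ_le_const2)
    have "(\<lambda>n. f (dyadic_floor (n + j) t)) \<longlonglongrightarrow> f t"
      using continuous_dyadic_floor_tendsto[OF cont t(1)] by (rule LIMSEQ_ignore_initial_segment)
    then show "(\<lambda>n. \<bar>f (dyadic_floor (j + n) t) - f (dyadic_floor j t)\<bar>)
        \<longlonglongrightarrow> \<bar>f t - f (dyadic_floor j t)\<bar>"
      unfolding add.commute[of j] by (intro tendsto_intros)
    show "\<exists>N. \<forall>n\<ge>N. \<bar>f (dyadic_floor (j + n) t) - f (dyadic_floor j t)\<bar> \<le> 9 * (9 / 10) ^ j"
    proof (intro exI allI impI)
      fix n
      have "0 \<le> 9 * (9 / 10 :: real) ^ (j + n)" by simp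
      with chain[OF j t, of n]
      show "\<bar>f (dyadic_floor (j + n) t) - f (dyadic_floor j t)\<bar> \<le> 9 * (9 / 10) ^ j" by linarith
    qed
  qed
  have main: "\<bar>f s - f t\<bar> \<le> 19 * (9 / 10) ^ j"
    if j: "m \<le> j" and s: "0 \<le> s" "s \<le> t" and t: "t \<le> real j" "t - s \<le> 1 / 2 ^ j" for j s t
  proof -
    define n n' where "n = nat \<lfloor>2 ^ j * s\<rfloor>" and "n' = nat \<lfloor>2 ^ j * t\<rfloor>"
    have "2 ^ j * s \<le> 2 ^ j * t" using s by simp
    moreover have "2 ^ j * t \<le> 2 ^ j * s + 1" using t(2) by (simp add: field_simps)
    ultimately have "n' = n \<or> n' = Suc n" unfolding n_def n'_def by linarith
    then have "\<bar>f (dyadic_floor j t) - f (dyadic_floor j s)\<bar> \<le> (9 / 10) ^ j"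
    proof
      assume n': "n' = Suc n"
      have "real (Suc n) / 2 ^ j = dyadic_floor j t"
        unfolding n'[symmetric] by (simp add: dyadic_floor_def n'_def)
      moreover have "real n / 2 ^ j = dyadic_floor j s"
        by (simp add: dyadic_floor_def n_def)
      ultimately show ?thesis
        using incr'[OF j, of n] dyadic_floor_le[of t j] s t by simp
    qed (simp add: n_def n'_def dyadic_floor_def)
    moreover have "\<bar>f s - f (dyadic_floor j s)\<bar> \<le> 9 * (9 / 10) ^ j"
      "\<bar>f t - f (dyadic_floor j t)\<bar> \<le> 9 * (9 / 10) ^ j"
      using s t by (auto intro!: floor[OF j])
    ultimately show ?thesis by linarith
  qed
  show ?thesis
    unfolding modulus_set_def
  proof (intro CollectI conjI allI impI ballI ext f0)
    fix j s t assume "m \<le> j" "s \<in> {0..real j}" "t \<in> {0..real j}" "\<bar>s - t\<bar> \<le> 1 / 2 ^ j"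
    then show "\<bar>f s - f t\<bar> \<le> 19 * (9 / 10) ^ j"
      using main[of j s t] main[of j t s] by (cases "s \<le> t") (auto simp: abs_minus_commute)
  qed
qed

text \<open>The base 9/10 is below 1, so the modulus vanishes, and above 2^(-1/4), so the tail
  series converges. At scale delta = 2^-j the modulus is 19 delta^a with a = log_2 (10/9).\<close>

definition holder_compact :: "nat \<Rightarrow> cpath set" where
  "holder_compact m = Abs_cpath ` modulus_set (\<lambda>j. 19 * (9 / 10) ^ j) m"

lemma compact_holder_compact: "compact (holder_compact m)"
proof -
  have "(\<lambda>j. 19 * (9 / 10 :: real) ^ j) \<longlonglongrightarrow> 19 * 0"
    by (intro tendsto_intros LIMSEQ_power_zero) auto
  then show ?thesis unfolding holder_compact_def
    by (intro compact_continuous_image continuous_on_Abs_cpath compact_modulus_set) simp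
qed

text \<open>The ratio \<open>1 / (2 \<cdot> (9 / 10)\<^sup>4)\<close> is what remains of the union bound over the \<open>j 2\<^sup>j\<close> dyadic intervals
  of length \<open>2\<^sup>-\<^sup>j\<close> in \<open>[0, j]\<close>, each contributing at most \<open>C (2\<^sup>-\<^sup>j)\<^sup>2 / (9 / 10)\<^sup>4\<^sup>j\<close>.\<close>

definition holder_tail :: "nat \<Rightarrow> real" where
  "holder_tail m = (\<Sum>j. real (j + m) * (1 / (2 * (9 / 10) ^ 4)) ^ (j + m))"

lemma summable_holder: "summable (\<lambda>j. real j * (1 / (2 * (9 / 10) ^ 4)) ^ j)"
proof -
  define r :: real where "r = 1 / (2 * (9 / 10) ^ 4)"
  have "norm r < 1" by (simp add: r_def power_divide)
  from geometric_deriv_sums[OF this] have "summable (\<lambda>j. of_nat (Suc j) * r ^ j)"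
    by (rule sums_summable)
  then have "summable (\<lambda>j. real j * r ^ j)"
    by (rule summable_comparison_test'[where N = 0]) (simp add: r_def mult_right_mono)
  then show ?thesis by (simp only: r_def)
qed

lemma holder_tail_tendsto: "holder_tail \<longlonglongrightarrow> 0"
proof (rule LIMSEQ_I)
  fix e :: real assume "0 < e"
  from suminf_exist_split[OF this summable_holder]
  show "\<exists>N. \<forall>m\<ge>N. norm (holder_tail m - 0) < e"
    by (simp only: holder_tail_def diff_0_right)
qed

text \<open>Markov's inequality for the fourth power bounds each dyadic increment, and a union bound
  controls the failure event \<open>B l\<close> of each level. Outside all \<open>B l\<close> with
  \<open>l \<ge> m\<close>, chaining puts the path into the compact set. The estimate involves
  \<open>X\<close> only through \<open>C\<close>, so it is uniform over families.\<close>

lemma kolmogorov_tightness: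
  fixes X :: "real \<Rightarrow> 'a \<Rightarrow> real"
  assumes M: "prob_space M" and meas: "\<And>t. 0 \<le> t \<Longrightarrow> X t \<in> borel_measurable M"
    and X: "\<And>\<omega>. \<omega> \<in> space M \<Longrightarrow> X 0 \<omega> = 0 \<and> continuous_on {0..} (\<lambda>t. X t \<omega>)"
    and int: "\<And>s t. 0 \<le> s \<Longrightarrow> s \<le> t \<Longrightarrow> integrable M (\<lambda>\<omega>. (X t \<omega> - X s \<omega>) ^ 4)"
    and incr: "\<And>s t. 0 \<le> s \<Longrightarrow> s \<le> t \<Longrightarrow> (\<integral>\<omega>. (X t \<omega> - X s \<omega>) ^ 4 \<partial>M) \<le> C * (t - s)\<^sup>2"
  shows "measure (path_law M X) (- holder_compact m) \<le> C * holder_tail m"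
proof -
  interpret prob_space M by fact
  define r :: real where "r = 1 / (2 * (9 / 10) ^ 4)"
  define A where "A l i = {\<omega>\<in>space M. (9 / 10) ^ l \<le> \<bar>X (real (Suc i) / 2 ^ l) \<omega> - X (real i / 2 ^ l) \<omega>\<bar>}"
    for l i
  define B where "B l = (\<Union>i\<in>{..<l * 2 ^ l}. A l i)" for l
  have Xm: "X (real i / 2 ^ l) \<in> borel_measurable M" for i l by (rule meas) simp
  have A_sets: "A l i \<in> events" for l i
    unfolding A_def using Xm[of i l] Xm[of "Suc i" l] by measurable
  have B_sets: "B l \<in> events" for l unfolding B_def using A_sets by auto
  have prob_A: "prob (A l i) \<le> C * (1 / (4 * (9 / 10) ^ 4)) ^ l" for l i
  proof -
    define Y where "Y \<omega> = X (real (Suc i) / 2 ^ l) \<omega> - X (real i / 2 ^ l) \<omega>" for \<omega>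
    have le: "real i / 2 ^ l \<le> real (Suc i) / 2 ^ l" by (intro divide_right_mono) auto
    have "((9 / 10) ^ l \<le> \<bar>y\<bar>) = (((9 / 10) ^ l) ^ 4 \<le> y ^ 4)" for y :: real
      using power_mono_iff[of "(9 / 10) ^ l" "\<bar>y\<bar>" 4] by simp
    then have "A l i = {\<omega>\<in>space M. ((9 / 10) ^ l) ^ 4 \<le> Y \<omega> ^ 4}"
      by (simp add: A_def Y_def)
    then have "prob (A l i) \<le> (\<integral>\<omega>. Y \<omega> ^ 4 \<partial>M) / ((9 / 10) ^ l) ^ 4"
      using int[OF _ le] unfolding Y_def
      by (simp only:) (rule integral_Markov_inequality_measure[where A = "{}"], auto)
    also have "\<dots> \<le> C * (1 / 2 ^ l)\<^sup>2 / ((9 / 10) ^ l) ^ 4"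
      using incr[OF _ le] unfolding Y_def
      by (intro divide_right_mono) (auto simp: diff_divide_distrib[symmetric])
    also have "\<dots> = C * (1 / (4 * (9 / 10) ^ 4)) ^ l"
    proof -
      have "((1 / 2 ^ l)\<^sup>2 :: real) = (1 / 4) ^ l"
        by (simp add: power_one_over power_mult[symmetric] mult.commute[of l] power_mult)
      moreover have "((9 / 10) ^ l) ^ 4 = ((9 / 10 :: real) ^ 4) ^ l"
        by (metis mult.commute power_mult)
      moreover have "C * (1 / 4) ^ l / q ^ l = C * (1 / (4 * q)) ^ l" for q :: real
        by (simp add: power_divide power_mult_distrib)
      ultimately show ?thesis by (simp only:)
    qed
    finally show ?thesis .
  qed
  have prob_B: "prob (B l) \<le> C * (real l * r ^ l)" for l
  proof -
    have "prob (B l) \<le> (\<Sum>i<l * 2 ^ l. prob (A l i))"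
      unfolding B_def using A_sets by (intro finite_measure_subadditive_finite) auto
    also have "\<dots> \<le> (\<Sum>i<l * 2 ^ l. C * (1 / (4 * (9 / 10) ^ 4)) ^ l)"
      by (intro sum_mono prob_A)
    also have "\<dots> = C * (real l * (2 ^ l * (1 / (4 * (9 / 10) ^ 4)) ^ l))" by simp
    also have "(2 ^ l * (1 / (4 * (9 / 10) ^ 4)) ^ l :: real) = r ^ l"
      unfolding power_mult_distrib[symmetric] r_def by simp
    finally show ?thesis .
  qed
  have sub: "sample_path X -` (- holder_compact m) \<inter> space M \<subseteq> (\<Union>j. B (j + m))"
  proof (rule subsetI, rule ccontr)
    fix \<omega> assume \<omega>: "\<omega> \<in> sample_path X -` (- holder_compact m) \<inter> space M" "\<omega> \<notin> (\<Union>j. B (j + m))"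
    define f where "f = restrict (\<lambda>t. X t \<omega>) {0..}"
    have "f \<in> modulus_set (\<lambda>j. 19 * (9 / 10) ^ j) m"
    proof (rule dyadic_increments_imp_modulus_set)
      show "continuous_on {0..} f"
        unfolding f_def using X \<omega>(1) by (subst continuous_on_cong[OF refl restrict_apply']) auto
      fix l i assume l: "m \<le> l" "i < l * 2 ^ l"
      then have "\<omega> \<notin> B (l - m + m)" using \<omega>(2) by blast
      then have "\<omega> \<notin> A l i" using l by (auto simp: B_def)
      then show "\<bar>f (real (Suc i) / 2 ^ l) - f (real i / 2 ^ l)\<bar> \<le> (9 / 10) ^ l"
        using \<omega>(1) by (auto simp: A_def f_def)
    qed (use X \<omega>(1) in \<open>auto simp: f_def\<close>)
    then show False using \<omega>(1) by (auto simp: holder_compact_def sample_path_def f_def)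
  qed
  have summ: "summable (\<lambda>j. C * (real (j + m) * r ^ (j + m)))"
    using summable_holder unfolding r_def
    by (intro summable_mult summable_ignore_initial_segment)
  then have summB: "summable (\<lambda>j. prob (B (j + m)))"
    by (rule summable_comparison_test'[where N = 0]) (simp only: real_norm_def abs_of_nonneg[OF measure_nonneg] prob_B)
  have sp: "sample_path X \<in> measurable M borel"
    using meas X by (intro sample_path_measurable) auto
  have "measure (path_law M X) (- holder_compact m) = prob (sample_path X -` (- holder_compact m) \<inter> space M)"
    unfolding path_law_def using borel_compact[OF compact_holder_compact]
    by (intro measure_distr sp) auto
  also have "\<dots> \<le> prob (\<Union>j. B (j + m))"
    using sub B_sets by (intro finite_measure_mono) auto
  also have "\<dots> \<le> (\<Sum>j. prob (B (j + m)))"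
    using B_sets summB by (intro finite_measure_subadditive_countably) auto
  also have "\<dots> \<le> (\<Sum>j. C * (real (j + m) * r ^ (j + m)))"
    using prob_B summB summ by (intro suminf_le)
  also have "\<dots> = C * holder_tail m"
    unfolding holder_tail_def r_def using summable_holder
    by (intro suminf_mult summable_ignore_initial_segment)
  finally show ?thesis .
qed

subsection \<open>Centered Gaussian variables\<close>

lemma distributed_std_normal_distr:
  assumes "distributed M lborel Z std_normal_density"
  shows "distr M borel Z = std_normal_distribution"
proof -
  have "distr M borel Z = distr M lborel Z" by (intro distr_cong) auto
  then show ?thesis using distributed_distr_eq_density[OF assms] by simp
qed

context prob_space
begin

text \<open>Mean 0 forces the constant or the parameter \<open>\<mu>\<close> to be 0; scaling then
  leaves only the standard normal to handle.\<close>

lemma gaussian_rv_centered_cases: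
  assumes "gaussian_rv M X" "expectation X = 0"
  obtains "X \<in> borel_measurable M" "AE \<omega> in M. X \<omega> = 0"
    | \<sigma> where "X \<in> borel_measurable M" "0 < \<sigma>"
      "distributed M lborel (\<lambda>\<omega>. X \<omega> / \<sigma>) std_normal_density"
proof -
  have X: "X \<in> borel_measurable M" using assms(1) by (simp add: gaussian_rv_def)
  from assms(1) consider c where "AE \<omega> in M. X \<omega> = c"
    | \<mu> \<sigma> where "0 < \<sigma>" "distributed M lborel X (\<lambda>x. ennreal (normal_density \<mu> \<sigma> x))"
    by (auto simp: gaussian_rv_def)
  then show thesis
  proof cases
    case 1
    have "expectation X = (\<integral>\<omega>. c \<partial>M)" using 1 X by (intro integral_cong_AE) auto
    then have "c = 0" using assms(2) by (simp add: prob_space)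
    then show thesis using 1 that(1)[OF X] by simp
  next
    case 2
    have "\<mu> = 0" using normal_distributed_expectation[OF 2] assms(2) by simp
    then show thesis using 2 that(2)[OF X 2(1)] normal_standard_normal_convert[OF 2(1), of X \<mu>] by simp
  qed
qed

text \<open>The standard normal moments (2k)! / (2^k k!) are 1 and 3 for k = 1 and 2, and scaling
  contributes the power 2k of \<open>\<sigma>\<close>.\<close>

lemma gaussian_rv_moments:
  assumes "gaussian_rv M X" "expectation X = 0"
  shows "integrable M (\<lambda>\<omega>. (X \<omega>)\<^sup>2)" "integrable M (\<lambda>\<omega>. X \<omega> ^ 4)"
    and "expectation (\<lambda>\<omega>. X \<omega> ^ 4) = 3 * (expectation (\<lambda>\<omega>. (X \<omega>)\<^sup>2))\<^sup>2"
proof -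
  from assms have "integrable M (\<lambda>\<omega>. (X \<omega>)\<^sup>2) \<and> integrable M (\<lambda>\<omega>. X \<omega> ^ 4) \<and>
    expectation (\<lambda>\<omega>. X \<omega> ^ 4) = 3 * (expectation (\<lambda>\<omega>. (X \<omega>)\<^sup>2))\<^sup>2"
  proof (cases rule: gaussian_rv_centered_cases)
    case 1
    have eq: "AE \<omega> in M. (X \<omega>)\<^sup>2 = 0" "AE \<omega> in M. X \<omega> ^ 4 = 0"
      using 1(2) by (auto elim: eventually_mono)
    have "integrable M (\<lambda>\<omega>. (X \<omega>)\<^sup>2)" "integrable M (\<lambda>\<omega>. X \<omega> ^ 4)"
      using eq 1(1) by (auto intro: integrable_cong_AE_imp[of M "\<lambda>_. 0"])
    moreover have "expectation (\<lambda>\<omega>. (X \<omega>)\<^sup>2) = 0" "expectation (\<lambda>\<omega>. X \<omega> ^ 4) = 0"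
      using eq by (auto intro: integral_eq_zero_AE)
    ultimately show ?thesis by simp
  next
    case (2 \<sigma>)
    define Z where "Z \<omega> = X \<omega> / \<sigma>" for \<omega>
    have D: "distributed M lborel Z std_normal_density" using 2 by (simp add: Z_def[abs_def])
    have X: "X \<omega> = \<sigma> * Z \<omega>" for \<omega> using 2 by (simp add: Z_def)
    have Z: "integrable M (\<lambda>\<omega>. Z \<omega> ^ (2 * k))"
      "expectation (\<lambda>\<omega>. Z \<omega> ^ (2 * k)) = fact (2 * k) / (2 ^ k * fact k)" for k
      using distributed_integrable[OF D, of "\<lambda>x. x ^ (2 * k)"]
        distributed_integral[OF D, of "\<lambda>x. x ^ (2 * k)"]
        std_normal_moment_even[of k]
      by (auto simp: has_bochner_integral_iff normal_density_nonneg)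
    from Z[of 1] Z[of 2] show ?thesis
      by (simp add: X power_mult_distrib fact_numeral power2_eq_square[of "\<sigma>\<^sup>2"] power_mult[symmetric])
  qed
  then show "integrable M (\<lambda>\<omega>. (X \<omega>)\<^sup>2)" "integrable M (\<lambda>\<omega>. X \<omega> ^ 4)"
    "expectation (\<lambda>\<omega>. X \<omega> ^ 4) = 3 * (expectation (\<lambda>\<omega>. (X \<omega>)\<^sup>2))\<^sup>2"
    by auto
qed

text \<open>The real part of the characteristic function at 1 times \<open>cis b\<close>. The law
  enters only through its variance.\<close>

lemma gaussian_rv_cos:
  assumes "gaussian_rv M X" "expectation X = 0"
  shows "expectation (\<lambda>\<omega>. cos (X \<omega> + b)) = exp (- expectation (\<lambda>\<omega>. (X \<omega>)\<^sup>2) / 2) * cos b"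
  using assms
proof (cases rule: gaussian_rv_centered_cases)
  case 1
  have "expectation (\<lambda>\<omega>. cos (X \<omega> + b)) = expectation (\<lambda>\<omega>. cos b)"
    using 1 by (intro integral_cong_AE) (auto elim: eventually_mono)
  moreover have "expectation (\<lambda>\<omega>. (X \<omega>)\<^sup>2) = 0"
    using 1(2) by (intro integral_eq_zero_AE) (auto elim: eventually_mono)
  ultimately show ?thesis by (simp add: prob_space)
next
  case (2 \<sigma>)
  define Z where "Z \<omega> = X \<omega> / \<sigma>" for \<omega>
  have D: "distributed M lborel Z std_normal_density" using 2 by (simp add: Z_def[abs_def])
  have X: "X \<omega> = \<sigma> * Z \<omega>" for \<omega> using 2 by (simp add: Z_def)
  have [measurable]: "Z \<in> borel_measurable M" unfolding Z_def using 2(1) by measurable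
  have "expectation (\<lambda>\<omega>. Z \<omega> ^ (2 * 1)) = fact (2 * 1) / (2 ^ 1 * fact 1)"
    using distributed_integral[OF D, of "\<lambda>x. x ^ (2 * 1)"] std_normal_moment_even[of 1]
    by (auto simp: has_bochner_integral_iff normal_density_nonneg)
  then have var: "expectation (\<lambda>\<omega>. (X \<omega>)\<^sup>2) = \<sigma>\<^sup>2"
    by (simp add: X power_mult_distrib)
  have "(\<integral>\<omega>. iexp (\<sigma> * Z \<omega>) \<partial>M) = char (distr M borel Z) \<sigma>"
    unfolding char_def by (subst integral_distr) auto
  also have "\<dots> = complex_of_real (exp (- \<sigma>\<^sup>2 / 2))"
    unfolding distributed_std_normal_distr[OF D] char_std_normal_distribution by simp
  finally have iexp: "(\<integral>\<omega>. iexp (X \<omega>) \<partial>M) = complex_of_real (exp (- \<sigma>\<^sup>2 / 2))"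
    by (simp add: X)
  have int: "integrable M (\<lambda>\<omega>. iexp (X \<omega>))"
    using 2(1) by (intro integrable_const_bound[where B = 1]) auto
  have "expectation (\<lambda>\<omega>. cos (X \<omega> + b)) = (\<integral>\<omega>. Re (iexp (X \<omega>) * cis b) \<partial>M)"
    by (simp add: cos_add Re_exp Im_exp)
  also have "\<dots> = Re (\<integral>\<omega>. iexp (X \<omega>) * cis b \<partial>M)"
    using int by (intro integral_Re integrable_mult_left) auto
  also have "\<dots> = exp (- \<sigma>\<^sup>2 / 2) * cos b"
    using int by (simp add: iexp)
  finally show ?thesis by (simp add: var)
qed

end

subsection \<open>The covariance kernel\<close>

text \<open>The difference quotient at 0 of \<open>\<lambda>h. r powr h\<close>, completed by the
  derivative.\<close>

definition powr_quot :: "real \<Rightarrow> real \<Rightarrow> real" where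
  "powr_quot r d = (if d = 0 then ln r else (r powr d - 1) / d)"

lemma powr_quot_continuous:
  assumes r: "0 < r"
  shows "isCont (powr_quot r) d"
proof (cases "d = 0")
  case True
  have "((\<lambda>h. r powr h) has_real_derivative ln r) (at 0)"
    unfolding powr_def using r by (auto intro!: derivative_eq_intros)
  then have "((\<lambda>h. (r powr h - 1) / h) \<longlongrightarrow> ln r) (at 0)"
    using r by (simp add: has_field_derivative_iff)
  moreover have "\<forall>\<^sub>F h in at 0. (r powr h - 1) / h = powr_quot r h"
    by (auto simp: eventually_at_filter powr_quot_def)
  ultimately have "(powr_quot r \<longlongrightarrow> ln r) (at 0)"
    by (rule Lim_transform_eventually)
  then show ?thesis using True by (simp add: isCont_def powr_quot_def)
next
  case False
  have "\<forall>\<^sub>F h in nhds d. powr_quot r h = (r powr h - 1) / h"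
    using t1_space_nhds[OF False] by eventually_elim (simp add: powr_quot_def)
  moreover have "isCont (\<lambda>h. (r powr h - 1) / h) d"
    using r False by (auto intro!: continuous_intros)
  ultimately show ?thesis by (rule isCont_cong[THEN iffD2])
qed

text \<open>At \<open>r = s / t\<close>, multiplication by \<open>s\<close> turns this bound into
  \<open>t - s\<close>, which is what makes increment variances at most linear in the time
  gap.\<close>

lemma powr_quot_bound:
  assumes r: "0 < r" "r \<le> 1" and d: "- 1 \<le> d"
  shows "\<bar>powr_quot r d\<bar> \<le> 1 / r - 1"
proof -
  have r': "r = exp (ln r)" "1 / r = exp (- ln r)" using r by (simp_all add: exp_minus field_simps)
  have powr: "r powr d = exp (d * ln r)" using r by (simp add: powr_def)
  have ln: "ln r \<le> 0" "- ln r \<le> 1 / r - 1"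
    using r exp_ge_add_one_self[of "- ln r"] by (auto simp: exp_minus field_simps)
  consider "d = 0" | "0 < d" | "d < 0" by linarith
  then show ?thesis
  proof cases
    case 1
    then show ?thesis using ln by (simp add: powr_quot_def)
  next
    case 2
    have "r powr d \<le> 1" using 2 r by (simp add: powr_le1)
    then have "\<bar>powr_quot r d\<bar> = (1 - r powr d) / d"
      using 2 by (simp add: powr_quot_def abs_if field_simps)
    also have "\<dots> \<le> - ln r"
      using 2 exp_ge_add_one_self[of "d * ln r"] by (simp add: powr field_simps)
    finally show ?thesis using ln by linarith
  next
    case 3
    \<comment> \<open>Convexity of exp between 0 and \<open>- ln r\<close>, with weight
      \<open>- d\<close> in (0, 1].\<close>
    have "exp ((1 - (- d)) *\<^sub>R 0 + (- d) *\<^sub>R (- ln r)) \<le> (1 - (- d)) * exp 0 + (- d) * exp (- ln r)"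
      using 3 d by (intro convex_onD[OF exp_convex]) auto
    then have le: "r powr d \<le> 1 + (- d) * (1 / r - 1)"
      using r'(2) by (simp add: powr algebra_simps)
    have "1 \<le> r powr d" using 3 ln by (simp add: powr mult_nonpos_nonpos)
    then have "\<bar>powr_quot r d\<bar> = (r powr d - 1) / (- d)"
      using 3 by (simp add: powr_quot_def abs_if field_simps)
    also have "\<dots> \<le> 1 / r - 1"
      using 3 le by (intro mult_imp_div_pos_le) (auto simp: mult.commute)
    finally show ?thesis .
  qed
qed

text \<open>For \<open>\<gamma> > - 1/2\<close>, an affine change of parameter taking
  \<open>p_hat \<gamma>\<close> to 0 and \<open>p_crit \<gamma>\<close> to -1/2; below criticality
  \<open>1 + d\<close> and \<open>1 + 2 * d\<close> are positive.\<close>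

definition G_exponent :: "real \<Rightarrow> real \<Rightarrow> real" where
  "G_exponent \<gamma> p = \<gamma> - p * (\<gamma> + 1)"

lemma G_exponent_gt:
  assumes "\<gamma> > - 1/2" "p < p_crit \<gamma>"
  shows "G_exponent \<gamma> p > - 1/2"
  using assms by (simp add: G_exponent_def p_crit_def field_simps)

lemma G_exponent_eq_0_iff: "\<gamma> > - 1/2 \<Longrightarrow> G_exponent \<gamma> p = 0 \<longleftrightarrow> p = p_hat \<gamma>"
  by (auto simp: G_exponent_def p_hat_def field_simps)

lemma isCont_G_exponent [continuous_intros]: "isCont (G_exponent \<gamma>) p"
  unfolding G_exponent_def by (intro continuous_intros)

text \<open>In terms of \<open>d = \<gamma> - p (\<gamma> + 1)\<close> the two branches of the kernel merge: at \<open>p = p_hat \<gamma>\<close>, i.e.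
  \<open>d = 0\<close>, the only singularity is the removable one of \<open>powr_quot\<close>.\<close>

lemma G_cov_eq:
  assumes \<gamma>: "\<gamma> > - 1/2" and p: "p < p_crit \<gamma>" and st: "0 \<le> s" "s \<le> t"
  defines "d \<equiv> G_exponent \<gamma> p"
  shows "G_cov \<gamma> p s t = s / ((1 + d) * (1 + 2 * d)) *
    (2 * \<gamma> * (\<gamma> + 1) + 1 + d + (d + d\<^sup>2 - \<gamma> * (\<gamma> + 1)) * powr_quot (s / t) d)"
proof (cases "s = 0")
  case True
  then show ?thesis by (simp add: G_cov_def)
next
  case False
  have d: "d > - 1/2" using G_exponent_gt[OF \<gamma> p] by (simp add: d_def)
  show ?thesis
  proof (cases "p = p_hat \<gamma>")
    case True
    then have "d = 0" using G_exponent_eq_0_iff[OF \<gamma>] by (simp add: d_def)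
    then show ?thesis using True False
      by (simp add: G_cov_def powr_quot_def algebra_simps power2_eq_square)
  next
    case pne: False
    then have d0: "d \<noteq> 0" using G_exponent_eq_0_iff[OF \<gamma>] by (simp add: d_def)
    have g1: "\<gamma> + 1 \<noteq> 0" using \<gamma> by simp
    have p_eq: "p = (\<gamma> - d) / (\<gamma> + 1)"
      using g1 by (simp add: d_def G_exponent_def field_simps)
    define x where "x = (s / t) powr d"
    have e1: "1 - p = (1 + d) / (\<gamma> + 1)" using g1 by (simp add: p_eq field_simps)
    have e2: "\<gamma> - p * (\<gamma> + 1) = d" by (simp add: d_def G_exponent_def)
    have e3: "2 * (1 - p) * (\<gamma> + 1) - 1 = 1 + 2 * d" using g1 by (simp add: p_eq field_simps)
    have "(2 - p) * (\<gamma> + 1) - 1 = \<gamma> + 1 + d"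
      by (simp add: d_def G_exponent_def algebra_simps)
    then have e4: "p * ((2 - p) * (\<gamma> + 1) - 1) = (\<gamma> - d) * (\<gamma> + 1 + d) / (\<gamma> + 1)"
      by (simp add: p_eq)
    have nz: "1 + d \<noteq> 0" "1 + 2 * d \<noteq> 0" using d by auto
    have "G_cov \<gamma> p s t = s / ((1 + d) / (\<gamma> + 1) * d) *
        (\<gamma> - (\<gamma> - d) * (\<gamma> + 1 + d) / (\<gamma> + 1) / (1 + 2 * d) * x)"
      unfolding G_cov_def e2 e3 e4 e1 using False pne by (simp add: x_def)
    \<comment> \<open>The factorisation \<open>(\<gamma> - d) * (\<gamma> + 1 + d) = \<gamma> *
      (\<gamma> + 1) - d - d\<^sup>2\<close> matches the terms with \<open>x\<close>; the others
      agree after clearing denominators.\<close>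
    also have "\<dots> = s / ((1 + d) * (1 + 2 * d)) *
        (2 * \<gamma> * (\<gamma> + 1) + 1 + d + (d + d\<^sup>2 - \<gamma> * (\<gamma> + 1)) * ((x - 1) / d))"
      using nz d0 g1 by (simp add: divide_simps) algebra
    finally show ?thesis using d0 by (simp add: powr_quot_def x_def)
  qed
qed

text \<open>The merged formula is continuous in the exponent, as its denominators stay positive
  above -1/2. The case \<open>s = 0\<close> is separate because continuity of
  \<open>powr_quot\<close> is established for positive ratios.\<close>

lemma G_cov_continuous:
  assumes \<gamma>: "\<gamma> > - 1/2" and p: "p \<in> {0..<p_crit \<gamma>}" and st: "0 \<le> s" "s \<le> t"
  shows "((\<lambda>q. G_cov \<gamma> q s t) \<longlongrightarrow> G_cov \<gamma> p s t) (at p within {0..<p_crit \<gamma>})"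
proof (cases "s = 0")
  case True
  then show ?thesis by (simp add: G_cov_def)
next
  case False
  define F where "F q = s / ((1 + G_exponent \<gamma> q) * (1 + 2 * G_exponent \<gamma> q)) *
    (2 * \<gamma> * (\<gamma> + 1) + 1 + G_exponent \<gamma> q + (G_exponent \<gamma> q + (G_exponent \<gamma> q)\<^sup>2 - \<gamma> * (\<gamma> + 1)) *
       powr_quot (s / t) (G_exponent \<gamma> q))" for q
  have "0 < s / t" using False st by simp
  then have "isCont F p"
    unfolding F_def using G_exponent_gt[OF \<gamma>, of p] p
    by (intro continuous_intros isCont_o2[OF isCont_G_exponent powr_quot_continuous]) auto
  then have "(F \<longlongrightarrow> F p) (at p within {0..<p_crit \<gamma>})"
    by (auto simp: isCont_def intro: tendsto_within_subset)
  moreover have eq: "G_cov \<gamma> q s t = F q" if "q \<in> {0..<p_crit \<gamma>}" for q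
    unfolding F_def using that st by (intro G_cov_eq[OF \<gamma>]) auto
  then have "\<forall>\<^sub>F q in at p within {0..<p_crit \<gamma>}. F q = G_cov \<gamma> q s t"
    by (simp add: eventually_at_filter)
  ultimately show ?thesis
    unfolding eq[OF p] by (rule Lim_transform_eventually)
qed

definition G_lipschitz :: "real \<Rightarrow> real \<Rightarrow> real" where
  "G_lipschitz \<gamma> d =
     (2 * \<gamma> * (\<gamma> + 1) + 1 + d + 2 * \<bar>d + d\<^sup>2 - \<gamma> * (\<gamma> + 1)\<bar>) / ((1 + d) * (1 + 2 * d))"

text \<open>The left side is the variance of an increment. Its only term not linear in
  \<open>s\<close> and \<open>t\<close> is controlled by
  \<open>s * \<bar>powr_quot (s / t) d\<bar> \<le> t - s\<close>, and \<open>G_lipschitz\<close>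
  collects the resulting coefficients.\<close>

lemma G_increment_le:
  assumes \<gamma>: "\<gamma> > - 1/2" and p: "p < p_crit \<gamma>" and st: "0 \<le> s" "s \<le> t"
  shows "G_cov \<gamma> p s s + G_cov \<gamma> p t t - 2 * G_cov \<gamma> p s t
    \<le> G_lipschitz \<gamma> (G_exponent \<gamma> p) * (t - s)"
proof -
  define d D A B where "d = G_exponent \<gamma> p" and "D = (1 + d) * (1 + 2 * d)"
    and "A = 2 * \<gamma> * (\<gamma> + 1) + 1 + d" and "B = d + d\<^sup>2 - \<gamma> * (\<gamma> + 1)"
  have d: "d > - 1/2" using G_exponent_gt[OF \<gamma> p] by (simp add: d_def)
  have D: "0 < D" using d by (simp add: D_def)
  \<comment> \<open>On the diagonal the ratio is 1, where \<open>powr_quot\<close> vanishes.\<close>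
  have diag: "G_cov \<gamma> p u u = u / D * A" if "0 \<le> u" for u
    using G_cov_eq[OF \<gamma> p that order_refl]
    by (cases "u = 0") (simp_all add: powr_quot_def A_def D_def d_def)
  have off: "G_cov \<gamma> p s t = s / D * (A + B * powr_quot (s / t) d)"
    using G_cov_eq[OF \<gamma> p st] by (simp add: A_def B_def D_def d_def)
  have "- (s * (B * powr_quot (s / t) d)) \<le> \<bar>B\<bar> * (s * \<bar>powr_quot (s / t) d\<bar>)"
    using st by (metis abs_ge_minus_self abs_mult abs_of_nonneg mult.left_commute)
  also have "s * \<bar>powr_quot (s / t) d\<bar> \<le> t - s"
  proof (cases "s = 0")
    case False
    then have "\<bar>powr_quot (s / t) d\<bar> \<le> 1 / (s / t) - 1"
      using st d by (intro powr_quot_bound) auto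
    then have "s * \<bar>powr_quot (s / t) d\<bar> \<le> s * (1 / (s / t) - 1)"
      using st by (intro mult_left_mono) auto
    also have "\<dots> = t - s" using False by (simp add: field_simps)
    finally show ?thesis .
  qed (use st in simp)
  finally have *: "- (s * (B * powr_quot (s / t) d)) \<le> \<bar>B\<bar> * (t - s)"
    by (simp add: mult_left_mono)
  have "G_cov \<gamma> p s s + G_cov \<gamma> p t t - 2 * G_cov \<gamma> p s t =
      (A * (t - s) - 2 * (s * (B * powr_quot (s / t) d))) / D"
    using st D by (simp add: diag off field_simps)
  also have "\<dots> \<le> (A * (t - s) + 2 * (\<bar>B\<bar> * (t - s))) / D"
  proof (rule divide_right_mono)
    show "A * (t - s) - 2 * (s * (B * powr_quot (s / t) d)) \<le> A * (t - s) + 2 * (\<bar>B\<bar> * (t - s))"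
      using * by linarith
  qed (use D in simp)
  also have "\<dots> = (A + 2 * \<bar>B\<bar>) / D * (t - s)"
    by (simp add: distrib_right)
  also have "(A + 2 * \<bar>B\<bar>) / D = G_lipschitz \<gamma> d"
    by (simp add: G_lipschitz_def A_def B_def D_def)
  finally show ?thesis by (simp add: d_def)
qed

text \<open>Continuity of the Lipschitz coefficient in \<open>p\<close>. The punctured filter omits
  \<open>p\<close> itself, so the limit law gets its own conclusion with the same
  \<open>C\<close>.\<close>

lemma G_increment_bound:
  assumes \<gamma>: "\<gamma> > - 1/2" and p: "p \<in> {0..<p_crit \<gamma>}"
  obtains C where "G_lipschitz \<gamma> (G_exponent \<gamma> p) \<le> C"
    "\<forall>\<^sub>F q in at p within {0..<p_crit \<gamma>}. G_lipschitz \<gamma> (G_exponent \<gamma> q) \<le> C"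
proof -
  define L where "L q = G_lipschitz \<gamma> (G_exponent \<gamma> q)" for q
  define C where "C = L p + 1"
  have "isCont L p"
    unfolding L_def G_lipschitz_def using G_exponent_gt[OF \<gamma>, of p] p
    by (intro continuous_intros) auto
  then have "(L \<longlongrightarrow> L p) (at p within {0..<p_crit \<gamma>})"
    by (auto simp: isCont_def intro: tendsto_within_subset)
  then have "\<forall>\<^sub>F q in at p within {0..<p_crit \<gamma>}. L q < C"
    by (rule order_tendstoD) (simp add: C_def)
  then have "\<forall>\<^sub>F q in at p within {0..<p_crit \<gamma>}. L q \<le> C"
    by eventually_elim simp
  then show thesis
    by (intro that[of C]) (auto simp: C_def L_def)
qed

subsection \<open>The Gaussian limit processes\<close>

context
  fixes \<gamma> p :: real and M :: "'a measure" and X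
  assumes G: "is_G_process \<gamma> p M X"
begin

interpretation prob_space M
  using G by (simp add: is_G_process_def gaussian_process_def)

lemma G_continuous: "\<omega> \<in> space M \<Longrightarrow> X 0 \<omega> = 0 \<and> continuous_on {0..} (\<lambda>t. X t \<omega>)"
  using G by (simp add: is_G_process_def)

lemma G_linear_combination:
  assumes "finite I" "I \<subseteq> {0..}"
  shows "gaussian_rv M (\<lambda>\<omega>. \<Sum>t\<in>I. a t * X t \<omega>)"
  using G assms by (simp add: is_G_process_def gaussian_process_def)

lemma G_marginal:
  assumes "0 \<le> t"
  shows "gaussian_rv M (X t)" "expectation (X t) = 0"
  using G_linear_combination[of "{t}" "\<lambda>_. 1"] G assms by (simp_all add: is_G_process_def)

lemma G_measurable: "0 \<le> t \<Longrightarrow> X t \<in> borel_measurable M"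
  using G_marginal(1) by (simp add: gaussian_rv_def)

lemma G_integrable: "0 \<le> t \<Longrightarrow> integrable M (X t)"
  using G_measurable gaussian_rv_moments(1)[OF G_marginal] by (rule square_integrable_imp_integrable)

lemma G_integrable_mult:
  assumes "0 \<le> s" "0 \<le> t"
  shows "integrable M (\<lambda>\<omega>. X s \<omega> * X t \<omega>)"
proof (rule Bochner_Integration.integrable_bound)
  show "integrable M (\<lambda>\<omega>. (X s \<omega>)\<^sup>2 + (X t \<omega>)\<^sup>2)"
    using gaussian_rv_moments(1)[OF G_marginal] assms by simp
  show "(\<lambda>\<omega>. X s \<omega> * X t \<omega>) \<in> borel_measurable M"
    using assms by (intro borel_measurable_times G_measurable)
  have "\<bar>x * y\<bar> \<le> x\<^sup>2 + y\<^sup>2" for x y :: real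
  proof -
    have "0 \<le> (\<bar>x\<bar> - \<bar>y\<bar>)\<^sup>2" by simp
    then have "2 * \<bar>x * y\<bar> \<le> x\<^sup>2 + y\<^sup>2" by (simp add: power2_diff abs_mult)
    then show ?thesis by simp
  qed
  then show "AE \<omega> in M. norm (X s \<omega> * X t \<omega>) \<le> norm ((X s \<omega>)\<^sup>2 + (X t \<omega>)\<^sup>2)"
    by simp
qed

text \<open>\<open>min\<close> and \<open>max\<close> put the times in the order in which the kernel
  is meaningful, so that double sums over index sets can use it.\<close>

lemma G_covariance:
  assumes "0 \<le> s" "0 \<le> t"
  shows "expectation (\<lambda>\<omega>. X s \<omega> * X t \<omega>) = G_cov \<gamma> p (min s t) (max s t)"
proof -
  have le: "expectation (\<lambda>\<omega>. X u \<omega> * X v \<omega>) = G_cov \<gamma> p u v" if "0 \<le> u" "u \<le> v" for u v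
    using G that by (simp add: is_G_process_def)
  show ?thesis
    using le[of s t] le[of t s] assms by (cases "s \<le> t") (simp_all add: mult.commute)
qed

lemma G_linear_combination_mean:
  assumes "I \<subseteq> {0..}"
  shows "expectation (\<lambda>\<omega>. \<Sum>t\<in>I. a t * X t \<omega>) = 0"
  using assms G_integrable G_marginal(2)
  by (subst Bochner_Integration.integral_sum) (auto intro!: sum.neutral)

lemma G_linear_combination_variance:
  assumes "I \<subseteq> {0..}"
  shows "expectation (\<lambda>\<omega>. (\<Sum>t\<in>I. a t * X t \<omega>)\<^sup>2) =
    (\<Sum>s\<in>I. \<Sum>t\<in>I. a s * a t * G_cov \<gamma> p (min s t) (max s t))"
proof -
  have nonneg: "0 \<le> t" if "t \<in> I" for t using assms that by auto
  have "expectation (\<lambda>\<omega>. (\<Sum>t\<in>I. a t * X t \<omega>)\<^sup>2) =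
      expectation (\<lambda>\<omega>. \<Sum>s\<in>I. \<Sum>t\<in>I. a s * a t * (X s \<omega> * X t \<omega>))"
    by (simp add: power2_eq_square sum_product mult_ac)
  also have "\<dots> = (\<Sum>s\<in>I. \<Sum>t\<in>I. a s * a t * expectation (\<lambda>\<omega>. X s \<omega> * X t \<omega>))"
    using nonneg G_integrable_mult
    by (simp add: Bochner_Integration.integral_sum Bochner_Integration.integrable_sum)
  finally show ?thesis using nonneg by (simp add: G_covariance)
qed

lemma G_fidi:
  assumes "finite I" "I \<subseteq> {0..}"
  shows "expectation (\<lambda>\<omega>. cos ((\<Sum>t\<in>I. a t * X t \<omega>) + b)) =
    exp (- (\<Sum>s\<in>I. \<Sum>t\<in>I. a s * a t * G_cov \<gamma> p (min s t) (max s t)) / 2) * cos b"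
  using gaussian_rv_cos[OF G_linear_combination[OF assms] G_linear_combination_mean[OF assms(2)]]
  by (simp add: G_linear_combination_variance[OF assms(2)])

lemma G_increment_moment:
  assumes \<gamma>: "\<gamma> > - 1/2" and p: "p < p_crit \<gamma>" and L: "G_lipschitz \<gamma> (G_exponent \<gamma> p) \<le> L"
    and st: "0 \<le> s" "s \<le> t"
  shows "integrable M (\<lambda>\<omega>. (X t \<omega> - X s \<omega>) ^ 4)"
    and "expectation (\<lambda>\<omega>. (X t \<omega> - X s \<omega>) ^ 4) \<le> 3 * L\<^sup>2 * (t - s)\<^sup>2"
proof -
  define Y where "Y \<omega> = X t \<omega> - X s \<omega>" for \<omega>
  \<comment> \<open>A difference of indicators, so that \<open>s = t\<close>, where
    \<open>{s, t}\<close> is a singleton, gives the coefficient 0.\<close>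
  define a where "a u = (if u = t then 1 else 0) - (if u = s then 1 else 0 :: real)" for u
  have Y: "(\<Sum>u\<in>{s, t}. a u * X u \<omega>) = Y \<omega>" for \<omega>
    by (cases "s = t") (auto simp: a_def Y_def)
  have gauss: "gaussian_rv M Y" "expectation Y = 0"
    using G_linear_combination[of "{s, t}" a] G_linear_combination_mean[of "{s, t}" a] st
    by (simp_all only: Y) auto
  show "integrable M (\<lambda>\<omega>. (X t \<omega> - X s \<omega>) ^ 4)"
    using gaussian_rv_moments(2)[OF gauss] by (simp add: Y_def)
  have t: "0 \<le> t" using st by simp
  have "expectation (\<lambda>\<omega>. (Y \<omega>)\<^sup>2) =
      expectation (\<lambda>\<omega>. X s \<omega> * X s \<omega> + X t \<omega> * X t \<omega> - 2 * (X s \<omega> * X t \<omega>))"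
    by (simp add: Y_def power2_eq_square algebra_simps)
  also have "\<dots> = G_cov \<gamma> p s s + G_cov \<gamma> p t t - 2 * G_cov \<gamma> p s t"
    using st t by (simp add: G_integrable_mult G_covariance)
  also have "\<dots> \<le> G_lipschitz \<gamma> (G_exponent \<gamma> p) * (t - s)"
    by (rule G_increment_le[OF \<gamma> p st])
  also have "\<dots> \<le> L * (t - s)"
    using L st by (intro mult_right_mono) auto
  finally have "(expectation (\<lambda>\<omega>. (Y \<omega>)\<^sup>2))\<^sup>2 \<le> (L * (t - s))\<^sup>2"
    by (intro power_mono) auto
  then show "expectation (\<lambda>\<omega>. (X t \<omega> - X s \<omega>) ^ 4) \<le> 3 * L\<^sup>2 * (t - s)\<^sup>2"
    using gaussian_rv_moments(3)[OF gauss] by (simp add: Y_def power_mult_distrib)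
qed

lemma G_tight:
  assumes "\<gamma> > - 1/2" "p < p_crit \<gamma>" "G_lipschitz \<gamma> (G_exponent \<gamma> p) \<le> L"
  shows "measure (path_law M X) (- holder_compact m) \<le> 3 * L\<^sup>2 * holder_tail m"
  by (rule kolmogorov_tightness)
    (use prob_space_axioms G_measurable G_continuous G_increment_moment[OF assms] in auto)

lemma G_sample_path_measurable: "sample_path X \<in> measurable M borel"
  using G_measurable G_continuous by (intro sample_path_measurable) auto

lemma G_path_law: "prob_space (path_law M X)" "sets (path_law M X) = sets borel"
  using prob_space_distr[OF G_sample_path_measurable] by (simp_all add: path_law_def)

text \<open>Gaussianity and the kernel determine these expectations, so their convergence in
  \<open>p\<close> reduces to continuity of \<open>G_cov\<close>.\<close>

lemma G_path_law_fidi: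
  assumes I: "finite I" "I \<subseteq> {0..}"
  shows "(\<integral>x. cos ((\<Sum>t\<in>I. a t * Rep_cpath x t) + b) \<partial>path_law M X) =
    exp (- (\<Sum>s\<in>I. \<Sum>t\<in>I. a s * a t * G_cov \<gamma> p (min s t) (max s t)) / 2) * cos b"
proof -
  have "(\<lambda>x. cos ((\<Sum>t\<in>I. a t * Rep_cpath x t) + b)) \<in> borel_measurable borel"
    using I by (intro borel_measurable_continuous_onI continuous_intros continuous_on_Rep_cpath) auto
  then have "(\<integral>x. cos ((\<Sum>t\<in>I. a t * Rep_cpath x t) + b) \<partial>path_law M X) =
      expectation (\<lambda>\<omega>. cos ((\<Sum>t\<in>I. a t * Rep_cpath (sample_path X \<omega>) t) + b))"
    unfolding path_law_def by (rule integral_distr[OF G_sample_path_measurable])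
  also have "\<dots> = expectation (\<lambda>\<omega>. cos ((\<Sum>t\<in>I. a t * X t \<omega>) + b))"
    using I(2) G_continuous
    by (intro Bochner_Integration.integral_cong refl arg_cong[where f = cos] arg_cong2[where f = "(+)"] sum.cong)
      (auto simp: sample_path_def Rep_cpath_Abs_restrict)
  finally show ?thesis by (simp add: G_fidi[OF I])
qed

end

section \<open>Weak continuity of the path laws in the recollection probability\<close>

theorem proposition2p14:
  fixes \<gamma> :: real
    and M :: "real \<Rightarrow> 'a measure"
    and G :: "real \<Rightarrow> real \<Rightarrow> 'a \<Rightarrow> real"
  assumes "\<gamma> > - 1/2"
    and "\<And>p. p \<in> {0..<p_crit \<gamma>} \<Longrightarrow> is_G_process \<gamma> p (M p) (G p)"
  shows "\<forall>p\<^sub>0\<in>{0..<p_crit \<gamma>}.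
    weakly_converges (\<lambda>p. path_law (M p) (G p)) (path_law (M p\<^sub>0) (G p\<^sub>0))
      (at p\<^sub>0 within {0..<p_crit \<gamma>})"
proof
  fix p\<^sub>0 assume p0: "p\<^sub>0 \<in> {0..<p_crit \<gamma>}"
  note G = assms(2)
  let ?F = "at p\<^sub>0 within {0..<p_crit \<gamma>}"
  have ev: "\<forall>\<^sub>F p in ?F. p \<in> {0..<p_crit \<gamma>}"
    by (simp add: eventually_at_filter)
  obtain L where L: "G_lipschitz \<gamma> (G_exponent \<gamma> p\<^sub>0) \<le> L"
    "\<forall>\<^sub>F p in ?F. G_lipschitz \<gamma> (G_exponent \<gamma> p) \<le> L"
    using G_increment_bound[OF assms(1) p0] .
  show "weakly_converges (\<lambda>p. path_law (M p) (G p)) (path_law (M p\<^sub>0) (G p\<^sub>0)) ?F"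
  proof (rule weakly_converges_cpathI)
    show "\<forall>\<^sub>F p in ?F. prob_space (path_law (M p) (G p)) \<and> sets (path_law (M p) (G p)) = sets borel"
      using ev by eventually_elim (use G_path_law[OF G] in simp)
    show "prob_space (path_law (M p\<^sub>0) (G p\<^sub>0))" "sets (path_law (M p\<^sub>0) (G p\<^sub>0)) = sets borel"
      using G_path_law[OF G[OF p0]] .
  next
    fix I a and b :: real assume I: "finite I" "I \<subseteq> {0 :: real..}"
    define V where "V p = exp (- (\<Sum>s\<in>I. \<Sum>t\<in>I. a s * a t * G_cov \<gamma> p (min s t) (max s t)) / 2) * cos b"
      for p
    have "(V \<longlongrightarrow> V p\<^sub>0) ?F"
      unfolding V_def using I(2) by (intro tendsto_intros G_cov_continuous[OF assms(1) p0]) auto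
    moreover have "\<forall>\<^sub>F p in ?F. V p = (\<integral>x. cos ((\<Sum>t\<in>I. a t * Rep_cpath x t) + b) \<partial>path_law (M p) (G p))"
      using ev by eventually_elim (simp add: V_def G_path_law_fidi[OF G I])
    ultimately show "((\<lambda>p. \<integral>x. cos ((\<Sum>t\<in>I. a t * Rep_cpath x t) + b) \<partial>path_law (M p) (G p)) \<longlongrightarrow>
        (\<integral>x. cos ((\<Sum>t\<in>I. a t * Rep_cpath x t) + b) \<partial>path_law (M p\<^sub>0) (G p\<^sub>0))) ?F"
      unfolding G_path_law_fidi[OF G[OF p0] I] V_def[symmetric] by (rule Lim_transform_eventually)
  next
    fix d :: real assume d: "0 < d"
    have "(\<lambda>m. 3 * L\<^sup>2 * holder_tail m) \<longlonglongrightarrow> 3 * L\<^sup>2 * 0"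
      by (intro tendsto_intros holder_tail_tendsto)
    then have "\<forall>\<^sub>F m in sequentially. 3 * L\<^sup>2 * holder_tail m < d"
      using d by (intro order_tendstoD) auto
    \<comment> \<open>\<open>m\<close> depends on \<open>L\<close> and \<open>d\<close> alone, so
      one compact set serves \<open>p\<^sub>0\<close> and all nearby \<open>p\<close>.\<close>
    then obtain m where m: "3 * L\<^sup>2 * holder_tail m < d"
      by (auto dest: eventually_happens)
    have tail: "measure (path_law (M p) (G p)) (- holder_compact m) \<le> d"
      if "p \<in> {0..<p_crit \<gamma>}" "G_lipschitz \<gamma> (G_exponent \<gamma> p) \<le> L" for p
      using G_tight[OF G[OF that(1)] assms(1) _ that(2), of m] that(1) m by simp
    show "\<exists>K. compact K \<and> measure (path_law (M p\<^sub>0) (G p\<^sub>0)) (- K) \<le> d \<and>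
        (\<forall>\<^sub>F p in ?F. measure (path_law (M p) (G p)) (- K) \<le> d)"
    proof (intro exI conjI)
      show "compact (holder_compact m)" by (rule compact_holder_compact)
      show "measure (path_law (M p\<^sub>0) (G p\<^sub>0)) (- holder_compact m) \<le> d"
        using tail[OF p0 L(1)] .
      show "\<forall>\<^sub>F p in ?F. measure (path_law (M p) (G p)) (- holder_compact m) \<le> d"
        using ev L(2) by eventually_elim (rule tail)
    qed
  qed
qed

end
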